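(* For $w\in F$, if the nested traversal normal form is $\eta(w)=a_1a_2\cdots a_p$ (each $a_i\in\{x_0^{\pm1},x_1^{\pm1}\}$), then $N(a_1a_2\cdots a_{i-1})\le N(a_1a_2\cdots a_i)$ for all $1\le i\le p$ (where the empty prefix represents the identity, with $N=0$).
   Context: $F$ is Thompson's group with generators $x_0,x_1$. Elements are represented by tree pair diagrams $(T_-,T_+)$ of finite rooted binary trees with equally many carets (a caret is a vertex with its two downward edges); carets are numbered in infix order starting at $1$; leaves are numbered left to right starting at $0$. A diagram is reduced if no pair of carets, one in each tree, both have two leaves with the same leaf numbers; each element has a unique reduced diagram $(T_-(w),T_+(w))$, and $N(w)$ is its number of carets in either tree. A caret is a right (left) caret if one of its edges lies on the right (left) side of the tree (the path of right (left) edges from the root); the root is both; other carets are interior. The infinite normal form of $w$ is $w=w_pw_n$ with $w_p$ a product of positive powers and $w_n$ of negative powers of the $x_i$; $w_n$ is represented by $(T_-(w),R_{N(w)})$ and $w_p^{-1}$ by $(T_+(w),R_{N(w)})$, where $R_k$ is the tree of $k$ right carets. Nested traversal word $\gamma(T)$ of a tree $T$: go through the carets of $T$ in infix order, skipping carets lying in the right subtree of a caret to which rule (3) or (5) has already been applied, and append: (1) nothing for the caret with infix number 1; (2) $x_0^{-1}$ for a left caret with infix number $>1$; (3) $x_0^{-1}\gamma(T')x_0x_1^{-1}$ for an interior caret with nonempty right subtree $T'$ (where $\gamma(T')$ is computed with $T'$ regarded as a tree in its own right); (4) $x_1^{-1}$ for an interior caret with empty right subtree; (5) $x_0^{-1}\gamma(T')x_0$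 for a non-root right caret whose right subtree $T'$ contains an interior caret; (6) nothing for a non-root right caret whose right subtree contains no interior caret. Set $\eta(w_n)=\gamma(T_-(w))$, $\eta(w_p)=\gamma(T_+(w))^{-1}$, and let the nested traversal normal form $\eta(w)$ be the free reduction of the word $\eta(w_p)\eta(w_n)$. For a word $u$, $N(u)$ means $N$ of the element $u$ represents.
   Formalization: In rules (3) and (5), γ(T') is computed with carets keeping their type (interior or right) from the whole tree, rather than with T' as a tree in its own right; under the literal rule η(w) need not represent w and the inequality can fail. *)

theory Defs
  imports Main
begin

datatype tree = Lf | Nd tree tree

fun carets :: "tree \<Rightarrow> nat" where
  "carets Lf = 0"
| "carets (Nd l r) = Suc (carets l + carets r)"

fun leaves :: "tree \<Rightarrow> bool list list" where
  "leaves Lf = [[]]"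
| "leaves (Nd l r) = map (Cons False) (leaves l) @ map (Cons True) (leaves r)"

fun rvine :: "nat \<Rightarrow> tree" where
  "rvine 0 = Lf"
| "rvine (Suc k) = Nd Lf (rvine k)"

type_synonym cantor = "nat \<Rightarrow> bool"
type_synonym elt = "cantor \<Rightarrow> cantor"

definition has_prefix :: "bool list \<Rightarrow> cantor \<Rightarrow> bool" where
  "has_prefix p s \<longleftrightarrow> (\<forall>k < length p. s k = p ! k)"

definition replace_prefix :: "bool list \<Rightarrow> bool list \<Rightarrow> cantor \<Rightarrow> cantor" where
  "replace_prefix p q s = (\<lambda>k. if k < length q then q ! k else s (k - length q + length p))"

fun lookup :: "bool list list \<Rightarrow> bool list list \<Rightarrow> cantor \<Rightarrow> cantor" where
  "lookup (p # ps) (q # qs) s = (if has_prefix p s then replace_prefix p q s else lookup ps qs s)"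
| "lookup _ _ s = s"

text \<open>The element represented by the tree pair diagram \<open>(Tm, Tp)\<close>: the dyadic piece given by
  leaf \<open>i\<close> of \<open>Tm\<close> is sent affinely onto the piece given by leaf \<open>i\<close> of \<open>Tp\<close>
  (realised as prefix replacement on infinite binary sequences, on which \<open>F\<close> acts faithfully).\<close>
definition diag :: "tree \<Rightarrow> tree \<Rightarrow> elt" where
  "diag Tm Tp = lookup (leaves Tm) (leaves Tp)"

datatype letter = X0 | X0i | X1 | X1i

fun inv_letter :: "letter \<Rightarrow> letter" where
  "inv_letter X0 = X0i" | "inv_letter X0i = X0" | "inv_letter X1 = X1i" | "inv_letter X1i = X1"

definition lvine2 :: tree where "lvine2 = Nd (Nd Lf Lf) Lf"
definition t1 :: tree where "t1 = Nd Lf (Nd (Nd Lf Lf) Lf)"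

fun letter_elt :: "letter \<Rightarrow> elt" where
  "letter_elt X0 = diag (rvine 2) lvine2"
| "letter_elt X0i = diag lvine2 (rvine 2)"
| "letter_elt X1 = diag (rvine 3) t1"
| "letter_elt X1i = diag t1 (rvine 3)"

text \<open>The element represented by a word (product written left to right, \<open>(T_-,T_+) = (R,T_+)(T_-,R)\<close>).\<close>
fun eval :: "letter list \<Rightarrow> elt" where
  "eval [] = id"
| "eval (a # u) = letter_elt a \<circ> eval u"

definition thompsonF :: "elt set" where
  "thompsonF = range eval"

fun exposed :: "tree \<Rightarrow> nat set" where
  "exposed Lf = {}"
| "exposed (Nd l r) =
     (if l = Lf \<and> r = Lf then {0}
      else exposed l \<union> (\<lambda>i. i + length (leaves l)) ` exposed r)"

definition reduced :: "tree \<Rightarrow> tree \<Rightarrow> bool" where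
  "reduced Tm Tp \<longleftrightarrow> exposed Tm \<inter> exposed Tp = {}"

definition rdiag :: "elt \<Rightarrow> tree \<times> tree" where
  "rdiag w = (THE (Tm, Tp). carets Tm = carets Tp \<and> reduced Tm Tp \<and> diag Tm Tp = w)"

definition Tminus :: "elt \<Rightarrow> tree" where "Tminus w = fst (rdiag w)"
definition Tplus :: "elt \<Rightarrow> tree" where "Tplus w = snd (rdiag w)"

definition NN :: "elt \<Rightarrow> nat" where "NN w = carets (Tminus w)"

definition Nw :: "letter list \<Rightarrow> nat" where "Nw u = NN (eval u)"

text \<open>A subtree (of the tree being traversed) contains no interior caret iff its carets are
  all on its own right spine.\<close>
fun is_rvine :: "tree \<Rightarrow> bool" where
  "is_rvine Lf = True"
| "is_rvine (Nd a b) = (a = Lf \<and> is_rvine b)"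

text \<open>Traversal in infix order, with the caret types (left/right/interior) taken relative
  to the tree \<open>T\<close> being traversed:
  \<open>trav_int\<close>: a subtree all of whose carets are interior;
  \<open>trav_left\<close>: the left subtree of the root (its left spine consists of left carets);
  \<open>trav_right\<close>: the right subtree of the root (its right spine consists of non-root right carets).\<close>
fun trav_int :: "tree \<Rightarrow> letter list" and
    trav_right :: "tree \<Rightarrow> letter list" where
  "trav_int Lf = []"
| "trav_int (Nd a b) =
     (if b = Lf then trav_int a @ [X1i]
      else trav_int a @ [X0i] @ trav_int b @ [X0, X1i])"
| "trav_right Lf = []"
| "trav_right (Nd a b) =
     trav_int a @ (if is_rvine b then [] else [X0i] @ trav_right b @ [X0])"

fun trav_left :: "tree \<Rightarrow> letter list" where
  "trav_left Lf = []"
| "trav_left (Nd a b) = trav_left a @ (if a = Lf then [] else [X0i]) @ trav_int b"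

fun gamma :: "tree \<Rightarrow> letter list" where
  "gamma Lf = []"
| "gamma (Nd l r) = trav_left l @ (if l = Lf then [] else [X0i]) @ trav_right r"

fun free_red :: "letter list \<Rightarrow> letter list" where
  "free_red [] = []"
| "free_red (a # u) =
     (case free_red u of
        [] \<Rightarrow> [a]
      | b # v \<Rightarrow> if b = inv_letter a then v else a # b # v)"

definition inv_word :: "letter list \<Rightarrow> letter list" where
  "inv_word u = rev (map inv_letter u)"

definition eta :: "elt \<Rightarrow> letter list" where
  "eta w = free_red (inv_word (gamma (Tplus w)) @ gamma (Tminus w))"

end

theory Submission
  imports Defs
begin

text \<open>
  Call an infinite binary word prefix \<open>p\<close> broken for \<open>f\<close> if \<open>f\<close> does not act on the cone of \<open>p\<close>
  by replacing \<open>p\<close> with another prefix. The broken prefixes are exactly the carets of the domain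
  tree of the reduced diagram, so \<open>N f\<close> is their number. A generator matches the cones at the
  leaves of its two trees, so \<open>N (f \<circ> a) \<le> N f\<close> as soon as all carets of the target tree of \<open>a\<close>
  are broken for \<open>f\<close>, for which it suffices to look at one deepest caret, at position \<open>loc a\<close>.

  The traversal word \<open>gamma T\<close> builds \<open>T\<close> from a right vine by rotations. With \<open>T = Tplus w\<close>, the
  caret destroyed by a rotation never occurs in \<open>T\<close>, mostly because it crosses a caret of \<open>T\<close>,
  which gives monotonicity along the positive part. With \<open>T = Tminus w\<close>, the caret created by a rotation contains a caret of \<open>T\<close>, which
  by reducedness is broken for \<open>w\<close>, and this gives monotonicity along the negative part. The only
  exceptions are the steps of an initial run \<open>X0i ^ m\<close> of \<open>gamma (Tminus w)\<close>; there an unbroken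
  caret forces \<open>gamma (Tplus w)\<close> to start with the same run, which free reduction cancels.\<close>

section \<open>Cones and tree pair diagrams\<close>

definition prepend :: "bool list \<Rightarrow> cantor \<Rightarrow> cantor" where
  "prepend p s = (\<lambda>k. if k < length p then p ! k else s (k - length p))"

definition maps_cone :: "elt \<Rightarrow> bool list \<Rightarrow> bool list \<Rightarrow> bool" where
  "maps_cone f p q \<longleftrightarrow> (\<forall>s. f (prepend p s) = prepend q s)"

definition broken :: "elt \<Rightarrow> bool list set" where
  "broken f = {p. \<nexists>q. maps_cone f p q}"

fun inner :: "tree \<Rightarrow> bool list set" where
  "inner Lf = {}"
| "inner (Nd l r) = insert [] (Cons False ` inner l \<union> Cons True ` inner r)"

lemma prepend_Nil [simp]: "prepend [] s = s"
  by (simp add: prepend_def)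

lemma prepend_append: "prepend (p @ q) s = prepend p (prepend q s)"
  by (auto simp: prepend_def fun_eq_iff nth_append)

lemma prepend_Cons_nth [simp]: "prepend (b # p) s 0 = b" "prepend (b # p) s (Suc k) = prepend p s k"
  by (auto simp: prepend_def)

lemma prepend_eq_Cons: "prepend (b # p) s = prepend (c # q) s' \<longleftrightarrow> b = c \<and> prepend p s = prepend q s'"
proof -
  have "f = g \<longleftrightarrow> f 0 = g 0 \<and> (\<forall>k. f (Suc k) = g (Suc k))" for f g :: cantor
    unfolding fun_eq_iff by (metis not0_implies_Suc)
  from this[of "prepend (b # p) s" "prepend (c # q) s'"] show ?thesis
    by (simp add: fun_eq_iff)
qed

lemma prepend_determines: "(\<And>s. prepend p s = prepend q s) \<Longrightarrow> p = q"
proof (induction p arbitrary: q)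
  case Nil
  show ?case
  proof (cases q)
    case (Cons b q')
    then show ?thesis
      using Nil[of "\<lambda>_. \<not> b"] by (metis prepend_Cons_nth(1) prepend_Nil)
  qed simp
next
  case (Cons b p)
  show ?case
  proof (cases q)
    case Nil
    then show ?thesis
      using Cons.prems[of "\<lambda>_. \<not> b"] by (metis prepend_Cons_nth(1) prepend_Nil)
  next
    case (Cons c q')
    then show ?thesis
      using Cons.prems Cons.IH[of q'] by (simp add: prepend_eq_Cons)
  qed
qed

lemma has_prefix_prepend [simp]: "has_prefix p (prepend p s)"
  by (simp add: has_prefix_def prepend_def)

lemma has_prefix_imp: "has_prefix p s \<Longrightarrow> \<exists>s'. s = prepend p s'"
  by (rule exI[of _ "\<lambda>k. s (k + length p)"]) (auto simp: has_prefix_def prepend_def fun_eq_iff)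

lemma has_prefix_Cons_prepend [simp]:
  "has_prefix (b # p) (prepend (c # q) s) \<longleftrightarrow> b = c \<and> has_prefix p (prepend q s)"
  by (metis has_prefix_imp has_prefix_prepend prepend_eq_Cons)

lemma replace_prefix_prepend [simp]: "replace_prefix p q (prepend p s) = prepend q s"
  by (auto simp: replace_prefix_def prepend_def fun_eq_iff)

lemma maps_coneD: "maps_cone f p q \<Longrightarrow> f (prepend p s) = prepend q s"
  by (simp add: maps_cone_def)

lemma maps_cone_id [simp]: "maps_cone id p p"
  by (simp add: maps_cone_def)

lemma maps_cone_append: "maps_cone f p q \<Longrightarrow> maps_cone f (p @ r) (q @ r)"
  by (simp add: maps_cone_def prepend_append)

lemma maps_cone_comp: "maps_cone g p q \<Longrightarrow> maps_cone f q r \<Longrightarrow> maps_cone (f \<circ> g) p r"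
  by (simp add: maps_cone_def)

lemma maps_cone_unique: "maps_cone f p q \<Longrightarrow> maps_cone f p q' \<Longrightarrow> q = q'"
  by (metis maps_cone_def prepend_determines)

lemma maps_cone_inj: "inj f \<Longrightarrow> maps_cone f p q \<Longrightarrow> maps_cone f p' q \<Longrightarrow> p = p'"
  by (metis injD maps_cone_def prepend_determines)

lemma maps_cone_inverse: "g \<circ> f = id \<Longrightarrow> maps_cone f p q \<Longrightarrow> maps_cone g q p"
  by (metis comp_apply id_apply maps_cone_def)

text \<open>Splitting off the first bit of the tail reduces to the two halves. This is what permits
  deleting a caret exposed in both trees of a diagram.\<close>

lemma maps_cone_join:
  assumes "maps_cone f (p @ [False]) (q @ [False])" "maps_cone f (p @ [True]) (q @ [True])"
  shows "maps_cone f p q"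
  unfolding maps_cone_def
proof
  fix s
  have "prepend [s 0] (\<lambda>k. s (Suc k)) = s"
    by (auto simp: prepend_def fun_eq_iff)
  then obtain b s' where "s = prepend [b] s'"
    by metis
  then show "f (prepend p s) = prepend q s"
    using assms by (cases b) (auto simp: maps_cone_def prepend_append)
qed

lemma broken_comp_iff: "maps_cone g p q \<Longrightarrow> p \<in> broken (f \<circ> g) \<longleftrightarrow> q \<in> broken f"
  by (auto simp: broken_def maps_cone_def)

lemma broken_prefix: "p @ r \<in> broken f \<Longrightarrow> p \<in> broken f"
  using maps_cone_append by (fastforce simp: broken_def)

abbreviation maps_cones :: "elt \<Rightarrow> bool list list \<Rightarrow> bool list list \<Rightarrow> bool" where
  "maps_cones f \<equiv> list_all2 (maps_cone f)"

lemma maps_cones_comp: "maps_cones g ps qs \<Longrightarrow> maps_cones f qs rs \<Longrightarrow> maps_cones (f \<circ> g) ps rs"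
  by (rule list_all2_trans[OF maps_cone_comp])

lemma maps_cones_map: "maps_cone f p q \<Longrightarrow> maps_cones f (map ((@) p) xs) (map ((@) q) xs)"
  by (auto simp: list_all2_conv_all_nth maps_cone_append)

section \<open>Leaves and carets of a tree as binary words\<close>

lemma leaves_nonempty [simp]: "leaves t \<noteq> []"
  by (induction t) auto

lemma length_leaves [simp]: "length (leaves t) = Suc (carets t)"
  by (induction t) auto

lemma leaves_eq_Nil_iff [simp]: "[] \<in> set (leaves t) \<longleftrightarrow> t = Lf"
  by (cases t) auto

lemma inner_Nil_iff [simp]: "[] \<in> inner t \<longleftrightarrow> t \<noteq> Lf"
  by (cases t) auto

lemma finite_inner [simp]: "finite (inner t)"
  by (induction t) auto

lemma card_inner [simp]: "card (inner t) = carets t"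
proof (induction t)
  case (Nd l r)
  have "card (Cons False ` inner l \<union> Cons True ` inner r) = carets l + carets r"
    using Nd by (subst card_Un_disjoint) (auto simp: card_image)
  then show ?case
    by (auto simp: card_insert_if)
qed simp

lemma leaves_cover: "\<exists>p \<in> set (leaves t). has_prefix p s"
proof (induction t arbitrary: s)
  case Lf
  then show ?case by (simp add: has_prefix_def)
next
  case (Nd l r)
  obtain p q where "p \<in> set (leaves l)" "has_prefix p (\<lambda>k. s (Suc k))"
    "q \<in> set (leaves r)" "has_prefix q (\<lambda>k. s (Suc k))"
    using Nd.IH by blast
  then have "has_prefix (s 0 # (if s 0 then q else p)) s"
    by (auto simp: has_prefix_def nth_Cons split: nat.split)
  then show ?case
    using \<open>p \<in> _\<close> \<open>q \<in> _\<close> by (cases "s 0") auto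
qed

text \<open>Ordered pairs suffice because \<open>lookup\<close> takes the first match: a word below
  a later leaf must not match an earlier one.\<close>

lemma leaves_disjoint:
  "sorted_wrt (\<lambda>p q. \<forall>s. \<not> has_prefix p (prepend q s)) (leaves t)"
  by (induction t) (auto simp: sorted_wrt_append sorted_wrt_map)

lemma maps_cone_lookup:
  assumes "length ps = length qs"
    and "sorted_wrt (\<lambda>p q. \<forall>s. \<not> has_prefix p (prepend q s)) ps"
  shows "list_all2 (maps_cone (lookup ps qs)) ps qs"
  using assms
proof (induction ps qs rule: list_induct2)
  case (Cons p ps q qs)
  have "maps_cone (lookup (p # ps) (q # qs)) p' q'" if "p' \<in> set ps" "maps_cone (lookup ps qs) p' q'" for p' q'
    using that Cons.prems unfolding maps_cone_def sorted_wrt.simps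
    by simp
  moreover have "list_all2 (\<lambda>p' q'. p' \<in> set ps \<and> maps_cone (lookup ps qs) p' q') ps qs"
    using Cons by (auto simp: list_all2_conv_all_nth)
  ultimately have "list_all2 (maps_cone (lookup (p # ps) (q # qs))) ps qs"
    by (auto elim: list_all2_mono)
  moreover have "maps_cone (lookup (p # ps) (q # qs)) p q"
    by (simp add: maps_cone_def)
  ultimately show ?case
    by (simp del: lookup.simps)
qed simp

lemma lookup_eqI:
  assumes "list_all2 (maps_cone f) ps qs" "\<exists>p \<in> set ps. has_prefix p s"
  shows "lookup ps qs s = f s"
  using assms
proof (induction ps qs rule: list_all2_induct)
  case (Cons p ps q qs)
  show ?case
  proof (cases "has_prefix p s")
    case True
    then show ?thesis
      using Cons.hyps(1) by (auto dest!: has_prefix_imp simp: maps_cone_def)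
  qed (use Cons in auto)
qed simp

text \<open>\<open>list_all2\<close> also forces equally many leaves, hence carets, and this
  cone-wise form turns composition of diagrams into transitivity.\<close>

definition represents :: "tree \<Rightarrow> tree \<Rightarrow> elt \<Rightarrow> bool" where
  "represents S T f \<longleftrightarrow> maps_cones f (leaves S) (leaves T)"

lemma represents_iff: "represents S T f \<longleftrightarrow> carets S = carets T \<and> diag S T = f"
proof
  assume "represents S T f"
  then show "carets S = carets T \<and> diag S T = f"
    using leaves_cover lookup_eqI
    by (auto simp: represents_def diag_def fun_eq_iff dest: list_all2_lengthD)
next
  assume "carets S = carets T \<and> diag S T = f"
  then show "represents S T f"
    using maps_cone_lookup[OF _ leaves_disjoint, of S "leaves T"]
    by (auto simp: represents_def diag_def list_all2_conv_all_nth)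
qed

lemma represents_comp: "represents S T g \<Longrightarrow> represents T U f \<Longrightarrow> represents S U (f \<circ> g)"
  unfolding represents_def by (rule list_all2_trans[OF maps_cone_comp])

lemma represents_id: "represents S S id"
  by (simp add: represents_def list_all2_refl)

lemma represents_self: "represents S S f \<Longrightarrow> f = id"
  using represents_id[of S] by (simp add: represents_iff)

section \<open>Reduced diagrams and broken prefixes\<close>

text \<open>A condition on neighbouring leaves can be transported along maps of cones. Across the
  root, the last leaf of \<open>l\<close> and the first leaf of \<open>r\<close> are siblings only
  if both subtrees are leaves.\<close>

lemma exposed_iff:
  "i \<in> exposed S \<longleftrightarrow> i < carets S \<and> (\<exists>p. leaves S ! i = p @ [False] \<and> leaves S ! Suc i = p @ [True])"
proof (induction S arbitrary: i)
  case (Nd l r)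
  let ?n = "Suc (carets l)"
  have nth: "leaves (Nd l r) ! j = (if j < ?n then False # leaves l ! j else True # leaves r ! (j - ?n))"
    if "j \<le> Suc (carets l + carets r)" for j
    using that by (auto simp: nth_append)
  consider "i < carets l" | "i = carets l" | "?n \<le> i" "i < ?n + carets r" | "?n + carets r \<le> i"
    by linarith
  then show ?case
  proof cases
    case 1
    have eq: "leaves (Nd l r) ! i = False # leaves l ! i" "leaves (Nd l r) ! Suc i = False # leaves l ! Suc i"
      using 1 nth[of i] nth[of "Suc i"] by auto
    have "(\<exists>p. leaves (Nd l r) ! i = p @ [False] \<and> leaves (Nd l r) ! Suc i = p @ [True])
      \<longleftrightarrow> (\<exists>p. leaves l ! i = p @ [False] \<and> leaves l ! Suc i = p @ [True])"
      unfolding eq by (auto simp: Cons_eq_append_conv)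
    then show ?thesis
      using 1 Nd.IH(1)[of i] by (cases l) auto
  next
    case 2
    have "leaves l ! i = [] \<Longrightarrow> l = Lf" "leaves r ! 0 = [] \<Longrightarrow> r = Lf"
      using 2 nth_mem[of i "leaves l"] nth_mem[of 0 "leaves r"] by auto
    then show ?thesis
      using 2 Nd.IH(1)[of i] nth[of i] nth[of "Suc i"]
      by (cases "l = Lf"; cases "r = Lf") (auto simp: Cons_eq_append_conv)
  next
    case 3
    have eq: "leaves (Nd l r) ! i = True # leaves r ! (i - ?n)" "leaves (Nd l r) ! Suc i = True # leaves r ! Suc (i - ?n)"
      using 3 nth[of i] nth[of "Suc i"] Suc_diff_le[of ?n i] by (simp_all del: diff_Suc_Suc leaves.simps)
    have "(\<exists>p. leaves (Nd l r) ! i = p @ [False] \<and> leaves (Nd l r) ! Suc i = p @ [True])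
      \<longleftrightarrow> (\<exists>p. leaves r ! (i - ?n) = p @ [False] \<and> leaves r ! Suc (i - ?n) = p @ [True])"
      unfolding eq by (auto simp: Cons_eq_append_conv)
    then show ?thesis
      using 3 Nd.IH(1)[of i] Nd.IH(2)[of "i - ?n"] by (cases r) (auto simp: image_iff intro: bexI[of _ "i - ?n"])
  next
    case 4
    then show ?thesis
      using Nd.IH by (auto simp: image_iff)
  qed
qed simp

lemma exposed_below_inner:
  "p \<in> inner S \<Longrightarrow>
    \<exists>i r. i < carets S \<and> leaves S ! i = p @ r @ [False] \<and> leaves S ! Suc i = p @ r @ [True]"
proof (induction S arbitrary: p)
  case (Nd l r)
  have left: "\<exists>i s. i < carets (Nd l r) \<and> leaves (Nd l r) ! i = False # q @ s @ [False]
        \<and> leaves (Nd l r) ! Suc i = False # q @ s @ [True]" if q: "q \<in> inner l" for q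
  proof -
    obtain i s where "i < carets l" "leaves l ! i = q @ s @ [False]" "leaves l ! Suc i = q @ s @ [True]"
      using Nd.IH(1)[OF q] by blast
    then show ?thesis
      by (intro exI[of _ i] exI[of _ s]) (simp add: nth_append)
  qed
  have right: "\<exists>i s. i < carets (Nd l r) \<and> leaves (Nd l r) ! i = True # q @ s @ [False]
        \<and> leaves (Nd l r) ! Suc i = True # q @ s @ [True]" if q: "q \<in> inner r" for q
  proof -
    obtain i s where "i < carets r" "leaves r ! i = q @ s @ [False]" "leaves r ! Suc i = q @ s @ [True]"
      using Nd.IH(2)[OF q] by blast
    then show ?thesis
      by (intro exI[of _ "i + Suc (carets l)"] exI[of _ s]) (simp add: nth_append)
  qed
  show ?case
  proof (cases p)
    case Nil
    consider "l = Lf" "r = Lf" | "[] \<in> inner l" | "[] \<in> inner r"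
      by fastforce
    then show ?thesis
    proof cases
      case 1
      then show ?thesis
        using Nil by (intro exI[of _ 0] exI[of _ "[]"]) simp
    next
      case 2
      then obtain i s where "i < carets (Nd l r)" "leaves (Nd l r) ! i = (False # s) @ [False]"
        "leaves (Nd l r) ! Suc i = (False # s) @ [True]"
        using left[OF 2] unfolding append_Nil append_Cons by blast
      then show ?thesis
        unfolding Nil append_Nil by blast
    next
      case 3
      then obtain i s where "i < carets (Nd l r)" "leaves (Nd l r) ! i = (True # s) @ [False]"
        "leaves (Nd l r) ! Suc i = (True # s) @ [True]"
        using right[OF 3] unfolding append_Nil append_Cons by blast
      then show ?thesis
        unfolding Nil append_Nil by blast
    qed
  next
    case (Cons b q)
    then show ?thesis
      using Nd.prems left right by (cases b) (auto simp del: leaves.simps)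
  qed
qed simp

lemma not_inner_imp: "p \<notin> inner S \<Longrightarrow> \<exists>i r. i \<le> carets S \<and> p = leaves S ! i @ r"
proof (induction S arbitrary: p)
  case (Nd l r)
  then obtain b q where p: "p = b # q"
    by (cases p) auto
  show ?case
  proof (cases b)
    case False
    then have "q \<notin> inner l"
      using Nd.prems p by auto
    then obtain i s where "i \<le> carets l" "q = leaves l ! i @ s"
      using Nd.IH(1) by blast
    then show ?thesis
      using p False by (intro exI[of _ i] exI[of _ s]) (simp add: nth_append)
  next
    case True
    then have "q \<notin> inner r"
      using Nd.prems p by auto
    then obtain i s where "i \<le> carets r" "q = leaves r ! i @ s"
      using Nd.IH(2) by blast
    then show ?thesis
      using p True by (intro exI[of _ "i + Suc (carets l)"] exI[of _ s]) (simp add: nth_append)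
  qed
qed simp

lemma leaf_append_not_inner: "q \<in> set (leaves S) \<Longrightarrow> q @ r \<notin> inner S"
  by (induction S arbitrary: q) auto

lemma inner_inject: "inner S = inner T \<Longrightarrow> S = T"
proof (induction S arbitrary: T)
  case Lf
  then show ?case by (cases T) auto
next
  case (Nd l r)
  then obtain l' r' where T: "T = Nd l' r'"
    by (cases T) auto
  have sub: "inner l = {p. False # p \<in> inner (Nd l r)}" "inner r = {p. True # p \<in> inner (Nd l r)}" for l r
    by auto
  have "inner l = inner l'" "inner r = inner r'"
    using Nd.prems T sub by metis+
  then show ?case
    using Nd.IH T by simp
qed

text \<open>A caret of \<open>S\<close> missing in \<open>T\<close> would lie at or below a leaf of
  \<open>T\<close>, which is also a leaf of \<open>S\<close>; but no caret lies there.\<close>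

lemma leaves_inject: "leaves S = leaves T \<Longrightarrow> S = T"
proof (rule inner_inject)
  have "inner S \<subseteq> inner T" if "leaves S = leaves T" for S T
  proof
    fix p
    assume p: "p \<in> inner S"
    show "p \<in> inner T"
    proof (rule ccontr)
      assume "p \<notin> inner T"
      then obtain i r where "i \<le> carets T" "p = leaves T ! i @ r"
        using not_inner_imp by blast
      then have "leaves T ! i \<in> set (leaves S)"
        using that by (metis length_leaves less_Suc_eq_le nth_mem)
      then show False
        using leaf_append_not_inner p \<open>p = _\<close> by metis
    qed
  qed
  then show "leaves S = leaves T \<Longrightarrow> inner S = inner T"
    by (metis subset_antisym)
qed

lemma represents_nth: "represents S T f \<Longrightarrow> i \<le> carets S \<Longrightarrow> maps_cone f (leaves S ! i) (leaves T ! i)"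
  by (simp add: represents_def list_all2_conv_all_nth)

lemma represents_carets: "represents S T f \<Longrightarrow> carets S = carets T"
  by (simp add: represents_iff)

lemma broken_subset_inner:
  assumes "represents S T f"
  shows "broken f \<subseteq> inner S"
proof
  fix p
  assume p: "p \<in> broken f"
  show "p \<in> inner S"
  proof (rule ccontr)
    assume "p \<notin> inner S"
    then obtain i r where "i \<le> carets S" "p = leaves S ! i @ r"
      using not_inner_imp by blast
    then show False
      using maps_cone_append[OF represents_nth[OF assms, of i], of r] p by (auto simp: broken_def)
  qed
qed

text \<open>If the cone of a caret \<open>p\<close> of \<open>S\<close> were kept intact, an exposed
  caret below \<open>p\<close> would go to a sibling pair of leaves of \<open>T\<close> with the
  same numbers.\<close>

lemma broken_reduced:
  assumes "represents S T f" "reduced S T"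
  shows "broken f = inner S"
proof
  show "inner S \<subseteq> broken f"
  proof (rule ccontr)
    assume "\<not> inner S \<subseteq> broken f"
    then obtain p q where p: "p \<in> inner S" "maps_cone f p q"
      by (auto simp: broken_def)
    obtain i r where i: "i < carets S" "leaves S ! i = p @ r @ [False]" "leaves S ! Suc i = p @ r @ [True]"
      using exposed_below_inner[OF p(1)] by blast
    have "leaves T ! i = q @ r @ [False]"
      by (rule maps_cone_unique[OF _ maps_cone_append[OF p(2)]])
        (use represents_nth[OF assms(1), of i] i in simp)
    moreover have "leaves T ! Suc i = q @ r @ [True]"
      by (rule maps_cone_unique[OF _ maps_cone_append[OF p(2)]])
        (use represents_nth[OF assms(1), of "Suc i"] i in simp)
    ultimately have "i \<in> exposed S" "i \<in> exposed T"
      using i represents_carets[OF assms(1)] unfolding exposed_iff append_assoc[symmetric] by auto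
    then show False
      using assms(2) by (auto simp: reduced_def)
  qed
qed (rule broken_subset_inner[OF assms(1)])

text \<open>The domain tree is read off from \<open>broken f\<close>; the leaves of the other tree
  are then the images of its leaves.\<close>

lemma reduced_unique:
  assumes "represents S T f" "reduced S T" "represents S' T' f" "reduced S' T'"
  shows "S = S' \<and> T = T'"
proof -
  have S: "S = S'"
    using broken_reduced[OF assms(1,2)] broken_reduced[OF assms(3,4)] by (auto intro: inner_inject)
  have "leaves T = leaves T'"
  proof (rule nth_equalityI)
    show "leaves T ! i = leaves T' ! i" if "i < length (leaves T)" for i
      by (rule maps_cone_unique[of f "leaves S ! i"])
        (use S that represents_carets[OF assms(1)] represents_nth[OF assms(1), of i] represents_nth[OF assms(3), of i] in auto)
  qed (use S represents_carets[OF assms(1)] represents_carets[OF assms(3)] in simp)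
  then show ?thesis
    using S leaves_inject by simp
qed

section \<open>Existence of reduced diagrams\<close>

lemma remove_exposed:
  "i \<in> exposed S \<Longrightarrow> \<exists>S' xs p ys. carets S = Suc (carets S') \<and> length xs = i \<and>
     leaves S = xs @ (p @ [False]) # (p @ [True]) # ys \<and> leaves S' = xs @ p # ys"
proof (induction S arbitrary: i)
  case (Nd l r)
  consider "l = Lf" "r = Lf" "i = 0" | "i \<in> exposed l" | j where "i = j + Suc (carets l)" "j \<in> exposed r"
    using Nd.prems by (auto split: if_splits)
  then show ?case
  proof cases
    case 1
    then show ?thesis
      by (intro exI[of _ Lf] exI[of _ "[]"]) simp
  next
    case 2
    then obtain S' xs p ys where "carets l = Suc (carets S')" "length xs = i"
      "leaves l = xs @ (p @ [False]) # (p @ [True]) # ys" "leaves S' = xs @ p # ys"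
      using Nd.IH(1) by blast
    then show ?thesis
      by (intro exI[of _ "Nd S' r"] exI[of _ "map (Cons False) xs"] exI[of _ "False # p"]
        exI[of _ "map (Cons False) ys @ map (Cons True) (leaves r)"]) simp
  next
    case 3
    then obtain S' xs p ys where "carets r = Suc (carets S')" "length xs = j"
      "leaves r = xs @ (p @ [False]) # (p @ [True]) # ys" "leaves S' = xs @ p # ys"
      using Nd.IH(2) by blast
    then show ?thesis
      using 3(1) by (intro exI[of _ "Nd l S'"] exI[of _ "map (Cons False) (leaves l) @ map (Cons True) xs"]
        exI[of _ "True # p"] exI[of _ "map (Cons True) ys"]) simp
  qed
qed simp

lemma reduced_exists:
  "represents S T f \<Longrightarrow> \<exists>S' T'. represents S' T' f \<and> reduced S' T'"
proof (induction "carets S" arbitrary: S T rule: less_induct)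
  case less
  show ?case
  proof (cases "reduced S T")
    case False
    then obtain i where i: "i \<in> exposed S" "i \<in> exposed T"
      by (auto simp: reduced_def)
    obtain S' xs p ys where S: "carets S = Suc (carets S')" "length xs = i"
      "leaves S = xs @ (p @ [False]) # (p @ [True]) # ys" "leaves S' = xs @ p # ys"
      using remove_exposed[OF i(1)] by blast
    obtain T' xs' p' ys' where T: "carets T = Suc (carets T')" "length xs' = i"
      "leaves T = xs' @ (p' @ [False]) # (p' @ [True]) # ys'" "leaves T' = xs' @ p' # ys'"
      using remove_exposed[OF i(2)] by blast
    have "represents S' T' f"
      using less.prems S T by (auto simp: represents_def list_all2_append intro: maps_cone_join)
    then show ?thesis
      using less.hyps[of S'] S(1) by simp
  qed (use less.prems in blast)
qed

section \<open>Common refinements of trees and composition of diagrams\<close>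

fun graft :: "tree \<Rightarrow> tree list \<Rightarrow> tree" where
  "graft Lf ts = hd ts"
| "graft (Nd l r) ts = Nd (graft l (take (Suc (carets l)) ts)) (graft r (drop (Suc (carets l)) ts))"

lemma leaves_graft:
  "length ts = Suc (carets S) \<Longrightarrow>
    leaves (graft S ts) = concat (map2 (\<lambda>p t. map ((@) p) (leaves t)) (leaves S) ts)"
proof (induction S arbitrary: ts)
  case Lf
  have "((@) []) = (id :: bool list \<Rightarrow> bool list)"
    by (simp add: fun_eq_iff)
  then show ?case
    using Lf by (auto simp: length_Suc_conv)
next
  case (Nd l r)
  define us where "us = take (Suc (carets l)) ts"
  define vs where "vs = drop (Suc (carets l)) ts"
  have l: "length us = Suc (carets l)" and r: "length vs = Suc (carets r)" and ts: "ts = us @ vs"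
    using Nd.prems by (auto simp: us_def vs_def)
  have "(@) (b # p) = (\<lambda>q. b # p @ q)" for b :: bool and p
    by (simp add: fun_eq_iff)
  then show ?case
    using Nd.IH(1)[OF l] Nd.IH(2)[OF r] l r
    by (simp add: ts map_concat zip_map1 comp_def split_beta)
qed

lemma represents_graft:
  assumes "represents S T f" "length ts = Suc (carets S)"
  shows "represents (graft S ts) (graft T ts) f"
proof -
  have "maps_cones f ps qs \<Longrightarrow>
    maps_cones f (concat (map2 (\<lambda>p t. map ((@) p) (leaves t)) ps us))
      (concat (map2 (\<lambda>p t. map ((@) p) (leaves t)) qs us))" for ps qs us
  proof (induction ps qs arbitrary: us rule: list_all2_induct)
    case step: (Cons p ps q qs)
    show ?case
    proof (cases us)
      case (Cons t us')
      then show ?thesis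
        using maps_cones_map[OF \<open>maps_cone f p q\<close>] step.IH[of us'] by (simp add: list_all2_appendI)
    qed simp
  qed simp
  then show ?thesis
    using assms represents_carets[OF assms(1)] by (simp add: represents_def leaves_graft)
qed

lemma graft_Lf: "graft S (replicate (Suc (carets S)) Lf) = S"
  by (induction S) (simp_all del: replicate.simps)

text \<open>The trees are superposed from the root down; where one ends in a leaf, the subtree of
  the other is grafted.\<close>

lemma common_graft:
  "\<exists>ts us. length ts = Suc (carets S) \<and> length us = Suc (carets T) \<and> graft S ts = graft T us"
proof (induction S arbitrary: T)
  case Lf
  show ?case
    by (rule exI[of _ "[T]"], rule exI[of _ "replicate (Suc (carets T)) Lf"])
      (simp add: graft_Lf del: replicate.simps graft.simps(2))
next
  case (Nd l r)
  show ?case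
  proof (cases T)
    case Lf
    show ?thesis
      by (rule exI[of _ "replicate (Suc (carets (Nd l r))) Lf"], rule exI[of _ "[Nd l r]"])
        (use graft_Lf[of "Nd l r"] in \<open>simp add: Lf del: replicate.simps graft.simps(2)\<close>)
  next
    case T: (Nd l' r')
    obtain ts us where l: "length ts = Suc (carets l)" "length us = Suc (carets l')" "graft l ts = graft l' us"
      using Nd.IH(1) by blast
    obtain ts' us' where r: "length ts' = Suc (carets r)" "length us' = Suc (carets r')"
      "graft r ts' = graft r' us'"
      using Nd.IH(2) by blast
    show ?thesis
      by (rule exI[of _ "ts @ ts'"], rule exI[of _ "us @ us'"]) (simp add: T l r)
  qed
qed

text \<open>Both diagrams are refined until the target tree of \<open>g\<close> is the domain tree
  of \<open>f\<close>.\<close>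

lemma represents_comp_exists:
  assumes "represents S T g" "represents S' T' f"
  shows "\<exists>S'' T''. represents S'' T'' (f \<circ> g)"
proof -
  obtain ts us where tu: "length ts = Suc (carets T)" "length us = Suc (carets S')" "graft T ts = graft S' us"
    using common_graft by blast
  then have "represents (graft S ts) (graft T ts) g" "represents (graft T ts) (graft T' us) f"
    using represents_graft[OF assms(1), of ts] represents_graft[OF assms(2), of us] represents_carets[OF assms(1)]
    by auto
  then show ?thesis
    using represents_comp by blast
qed

section \<open>Multiplication by a generator\<close>

text \<open>The deepest caret of the target tree of \<open>a\<close>, which is
  \<open>dom_tree (inv_letter a)\<close>. The carets of that tree form a chain of prefixes of
  \<open>loc a\<close>.\<close>

definition loc :: "letter \<Rightarrow> bool list" where
  "loc a = (case a of X0 \<Rightarrow> [False] | X0i \<Rightarrow> [True] | X1 \<Rightarrow> [True, False] | X1i \<Rightarrow> [True, True])"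

fun dom_tree :: "letter \<Rightarrow> tree" where
  "dom_tree X0 = rvine 2" | "dom_tree X0i = lvine2" | "dom_tree X1 = rvine 3" | "dom_tree X1i = t1"

lemma inv_letter_inv_letter [simp]: "inv_letter (inv_letter a) = a"
  by (cases a) auto

lemma represents_letter: "represents (dom_tree a) (dom_tree (inv_letter a)) (letter_elt a)"
  by (cases a) (auto simp: represents_iff lvine2_def t1_def numeral_eq_Suc)

lemma inner_dom_tree: "p \<in> inner (dom_tree (inv_letter a)) \<Longrightarrow> \<exists>r. loc a = p @ r"
  by (cases a) (auto simp: loc_def lvine2_def t1_def numeral_eq_Suc)

lemma letter_elt_inverse [simp]: "letter_elt (inv_letter a) \<circ> letter_elt a = id"
  using represents_comp[OF represents_letter[of a]] represents_letter[of "inv_letter a"]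
  by (auto intro: represents_self)

lemma eval_append: "eval (u @ v) = eval u \<circ> eval v"
  by (induction u) auto

lemma inv_word_simps [simp]: "inv_word [] = []" "inv_word (a # u) = inv_word u @ [inv_letter a]"
  "inv_word (u @ v) = inv_word v @ inv_word u" "length (inv_word u) = length u"
  by (auto simp: inv_word_def)

lemma inv_word_inv_word [simp]: "inv_word (inv_word u) = u"
  by (simp add: inv_word_def rev_map comp_def)

lemma eval_inv_word: "eval (inv_word u) \<circ> eval u = id"
proof (induction u)
  case (Cons a u)
  have "eval (inv_word (a # u)) \<circ> eval (a # u)
    = eval (inv_word u) \<circ> (letter_elt (inv_letter a) \<circ> letter_elt a) \<circ> eval u"
    by (simp add: eval_append comp_assoc del: letter_elt_inverse)
  then show ?case
    using Cons by (simp only: letter_elt_inverse comp_id id_comp)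
qed simp

lemma eval_inv_word': "eval u \<circ> eval (inv_word u) = id"
  using eval_inv_word[of "inv_word u"] by simp

lemma inj_eval: "inj (eval u)"
  using eval_inv_word by (metis inj_on_id inj_on_imageI2)

lemma maps_cone_inv_word: "maps_cone (eval (inv_word u)) p q \<longleftrightarrow> maps_cone (eval u) q p"
  using maps_cone_inverse eval_inv_word eval_inv_word' by metis

lemma represents_eval: "\<exists>S T. represents S T (eval u)"
proof (induction u)
  case Nil
  then show ?case
    using represents_id by (auto simp: id_def)
next
  case (Cons a u)
  then show ?case
    using represents_comp_exists[OF _ represents_letter] by (metis eval.simps(2))
qed

lemma rdiag_eval:
  "represents (Tminus (eval u)) (Tplus (eval u)) (eval u)" "reduced (Tminus (eval u)) (Tplus (eval u))"
proof -
  obtain S T where ST: "represents S T (eval u)" "reduced S T"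
    using represents_eval reduced_exists by metis
  then have "rdiag (eval u) = (S, T)"
    unfolding rdiag_def using reduced_unique
    by (intro the_equality) (auto simp: represents_iff)
  then show "represents (Tminus (eval u)) (Tplus (eval u)) (eval u)"
     "reduced (Tminus (eval u)) (Tplus (eval u))"
    using ST by (auto simp: Tminus_def Tplus_def)
qed

section \<open>Counting broken prefixes\<close>

lemma broken_eval: "broken (eval u) = inner (Tminus (eval u))"
  using broken_reduced rdiag_eval by metis

lemma Nw_eq: "Nw u = card (broken (eval u))"
  by (simp add: Nw_def NN_def broken_eval)

text \<open>Away from the carets of \<open>S\<close>, \<open>g\<close> replaces prefixes injectively
  and carries broken prefixes of \<open>f \<circ> g\<close> to broken prefixes of \<open>f\<close>
  at or below leaves of \<open>T\<close>.\<close>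

lemma card_broken_outside:
  assumes "represents S T g" "inj g" "finite (broken f)"
  shows "card (broken (f \<circ> g) - inner S) \<le> card (broken f - inner T)"
proof (rule card_inj_on_le)
  define \<phi> where "\<phi> p = (THE q. maps_cone g p q)" for p
  have \<phi>: "\<exists>i r. i \<le> carets S \<and> maps_cone g p (\<phi> p) \<and> \<phi> p = leaves T ! i @ r" if p: "p \<notin> inner S" for p
  proof -
    obtain i r where i: "i \<le> carets S" "p = leaves S ! i @ r"
      using not_inner_imp p by blast
    then have m: "maps_cone g p (leaves T ! i @ r)"
      using represents_nth[OF assms(1)] maps_cone_append by blast
    moreover have "\<phi> p = leaves T ! i @ r"
      unfolding \<phi>_def by (rule the_equality, rule m, erule maps_cone_unique[OF _ m])
    ultimately show ?thesis
      using i by metis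
  qed
  show "inj_on \<phi> (broken (f \<circ> g) - inner S)"
    using \<phi> maps_cone_inj[OF assms(2)] by (intro inj_onI) (metis DiffD2)
  show "\<phi> ` (broken (f \<circ> g) - inner S) \<subseteq> broken f - inner T"
  proof safe
    fix p
    assume p: "p \<in> broken (f \<circ> g)" "p \<notin> inner S"
    then obtain i r where i: "i \<le> carets S" "maps_cone g p (\<phi> p)" "\<phi> p = leaves T ! i @ r"
      using \<phi> by blast
    show "\<phi> p \<in> broken f"
      using p(1) i(2) broken_comp_iff by blast
    have "leaves T ! i \<in> set (leaves T)"
      using i(1) represents_carets[OF assms(1)] by (intro nth_mem) simp
    then show "\<phi> p \<in> inner T \<Longrightarrow> False"
      using leaf_append_not_inner i(3) by metis
  qed
qed (use assms in auto)

text \<open>At most all carets of \<open>S\<close> are broken for the composite, while all carets of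
  \<open>T\<close> are broken for \<open>f\<close>, and there are equally many of both.\<close>

lemma card_broken_comp:
  assumes "represents S T g" "inj g" "finite (broken f)" "finite (broken (f \<circ> g))" "inner T \<subseteq> broken f"
  shows "card (broken (f \<circ> g)) \<le> card (broken f)"
proof -
  have "broken (f \<circ> g) \<subseteq> (broken (f \<circ> g) - inner S) \<union> inner S"
    by blast
  then have "card (broken (f \<circ> g)) \<le> card ((broken (f \<circ> g) - inner S) \<union> inner S)"
    using assms(4) by (intro card_mono) auto
  also have "\<dots> \<le> card (broken f - inner T) + carets S"
    using card_Un_le[of "broken (f \<circ> g) - inner S" "inner S"] card_broken_outside[OF assms(1-3)] by simp
  also have "\<dots> = card (broken f)"
    using assms(5) represents_carets[OF assms(1)] by (simp add: card_Diff_subset) (metis assms(3) card_inner card_mono le_add_diff_inverse2)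
  finally show ?thesis .
qed

lemma Nw_append_le:
  assumes "loc a \<in> broken (eval u)"
  shows "Nw (u @ [a]) \<le> Nw u"
proof -
  have "inner (dom_tree (inv_letter a)) \<subseteq> broken (eval u)"
    using inner_dom_tree broken_prefix assms by (metis subsetI)
  moreover have "finite (broken (eval v))" for v
    by (simp add: broken_eval)
  moreover have "inj (letter_elt a)"
    using inj_eval[of "[a]"] by simp
  ultimately show ?thesis
    using card_broken_comp[OF represents_letter[of a], of "eval u"]
    by (simp add: Nw_eq eval_append) (metis eval.simps comp_id eval_append)
qed

lemma Nw_append_ge:
  assumes "loc (inv_letter a) \<in> broken (eval (u @ [a]))"
  shows "Nw u \<le> Nw (u @ [a])"
proof -
  have "eval ((u @ [a]) @ [inv_letter a]) = eval u"
    using letter_elt_inverse[of "inv_letter a"] by (simp add: eval_append comp_assoc)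
  then show ?thesis
    using Nw_append_le[OF assms] by (simp add: Nw_eq)
qed

text \<open>A prefix is unbroken for the inverse of \<open>eval (a # s)\<close> exactly when
  \<open>eval (a # s)\<close> maps some cone onto its cone. So the hypothesis says that
  \<open>loc a\<close> is broken for \<open>eval (inv_word (a # s))\<close>.\<close>

lemma Nw_suffix:
  assumes "\<nexists>q. maps_cone (eval (a # s)) q (loc a)"
  shows "Nw (inv_word s) \<le> Nw (inv_word (a # s))"
proof (rule Nw_append_ge[of "inv_letter a" "inv_word s", folded inv_word_simps(2)])
  show "loc (inv_letter (inv_letter a)) \<in> broken (eval (inv_word (a # s)))"
    using assms by (simp add: broken_def maps_cone_inv_word del: inv_word_simps)
qed

section \<open>The element of a traversal word\<close>

lemma cone_Nil: "maps_cone (eval []) p p"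
  by (simp add: maps_cone_def)

lemma cone_letter:
  assumes "maps_cone (eval v) p (q @ r)" "maps_cone (letter_elt a) q q'"
  shows "maps_cone (eval (a # v)) p (q' @ r)"
  using maps_cone_comp[OF assms(1) maps_cone_append[OF assms(2)]] by simp

lemma letter_cones:
  "maps_cone (letter_elt X0) [False] [False, False]"
  "maps_cone (letter_elt X0) [True, False] [False, True]"
  "maps_cone (letter_elt X0) [True, True] [True]"
  "maps_cone (letter_elt X0i) [False, False] [False]"
  "maps_cone (letter_elt X0i) [False, True] [True, False]"
  "maps_cone (letter_elt X0i) [True] [True, True]"
  "maps_cone (letter_elt X1i) [False] [False]"
  "maps_cone (letter_elt X1i) [True, False, False] [True, False]"
  "maps_cone (letter_elt X1i) [True, False, True] [True, True, False]"
  "maps_cone (letter_elt X1i) [True, True] [True, True, True]"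
  using represents_letter[of X0] represents_letter[of X0i] represents_letter[of X1i]
  by (simp_all add: represents_def lvine2_def t1_def numeral_eq_Suc del: letter_elt.simps)

text \<open>These rules push a cone through one more letter by \<open>THEN\<close>. In names such as
  \<open>X0i_01\<close> the digits are the leading bits on which the letter acts.\<close>

lemmas letter_cones' = letter_cones[THEN cone_letter[rotated], unfolded append.simps]
lemmas X0_0 = letter_cones'(1) and X0_10 = letter_cones'(2) and X0_11 = letter_cones'(3)
  and X0i_00 = letter_cones'(4) and X0i_01 = letter_cones'(5) and X0i_1 = letter_cones'(6)
  and X1i_0 = letter_cones'(7) and X1i_100 = letter_cones'(8) and X1i_101 = letter_cones'(9)
  and X1i_11 = letter_cones'(10)

abbreviation ones :: "nat \<Rightarrow> bool list" where "ones n \<equiv> replicate n True"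

text \<open>All leaves of \<open>rvine n\<close>, from left to right, except the last.\<close>

definition comb :: "nat \<Rightarrow> bool list list" where
  "comb n = map (\<lambda>i. ones i @ [False]) [0..<n]"

lemma comb_add: "comb (m + n) = comb m @ map ((@) (ones m)) (comb n)"
  by (induction n) (simp_all add: comb_def replicate_add)

lemma comb_Suc: "comb (Suc n) = [False] # map (Cons True) (comb n)"
  using comb_add[of 1 n] by (simp add: comb_def fun_eq_iff)

lemma leaves_rvine: "leaves (rvine n) = comb n @ [ones n]"
  by (induction n) (simp_all add: comb_Suc, simp add: comb_def)

lemma carets_rvine [simp]: "carets (rvine n) = n"
  by (induction n) auto

lemma leaves_rvine_add: "leaves (rvine (m + n)) = comb m @ map ((@) (ones m)) (leaves (rvine n))"
  by (simp add: leaves_rvine comb_add replicate_add)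

lemma is_rvine_imp: "is_rvine t \<Longrightarrow> t = rvine (carets t)"
  by (induction t) auto

lemma is_rvine_rvine: "is_rvine (rvine n)"
  by (induction n) auto

lemma maps_cones_Nd:
  assumes "maps_cones f (map ((@) p0) (leaves l)) xs" "maps_cones f (map ((@) p1) (leaves r)) ys"
    and "p0 = p @ [False]" "p1 = p @ [True]"
  shows "maps_cones f (map ((@) p) (leaves (Nd l r))) (xs @ ys)"
proof -
  have "map ((@) p) (leaves (Nd l r)) = map ((@) (p @ [False])) (leaves l) @ map ((@) (p @ [True])) (leaves r)"
    by simp
  then show ?thesis
    using assms by (simp only: list_all2_appendI)
qed

lemma cone_append:
  assumes "maps_cone (eval v) p (q @ r)" "maps_cone (eval u) q q'"
  shows "maps_cone (eval (u @ v)) p (q' @ r)"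
  using maps_cone_comp[OF assms(1) maps_cone_append[OF assms(2)]] by (simp add: eval_append)

lemma cone_append_0:
  "maps_cone (eval v) p (False # r) \<Longrightarrow> maps_cone (eval u) [False] [False] \<Longrightarrow>
    maps_cone (eval (u @ v)) p (False # r)"
  using cone_append[of v p "[False]" r u "[False]"] by simp

text \<open>Words act from right to left. A subtree \<open>t\<close> at \<open>[True, False]\<close>
  is unrolled onto the right side of the tree: what lies at \<open>[True, True]\<close> is pushed
  down by \<open>carets t\<close>, and the cone of \<open>[False]\<close> stays fixed.\<close>

lemma eval_trav_int:
  "maps_cone (eval (trav_int t)) [False] [False]"
  "maps_cone (eval (trav_int t)) [True, True] (ones (Suc (Suc (carets t))))"
  "maps_cones (eval (trav_int t)) (map ((@) [True, False]) (leaves t)) (map ((@) [True]) (comb (Suc (carets t))))"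
proof (induction t)
  case Lf
  {
    case 1 show ?case by (simp add: maps_cone_def)
  next
    case 2 show ?case by (simp add: maps_cone_def)
  next
    case 3 show ?case by (simp add: maps_cone_def comb_def)
  }
next
  case (Nd a b)
  \<comment> \<open>\<open>v\<close> acts first: it rotates the root of the subtree and unrolls
    \<open>b\<close>, leaving \<open>a\<close> at \<open>[True, False]\<close>.\<close>
  define v where "v = (if b = Lf then [X1i] else X0i # trav_int b @ [X0, X1i])"
  have split: "trav_int (Nd a b) = trav_int a @ v"
    by (simp add: v_def)
  have "maps_cone (eval v) [False] [False] \<and>
    maps_cone (eval v) [True, False, False] [True, False] \<and>
    maps_cone (eval v) [True, True] (ones (carets b + 3)) \<and>
    maps_cones (eval v) (map ((@) [True, False, True]) (leaves b)) (map ((@) [True, True]) (comb (Suc (carets b))))"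
  proof (cases "b = Lf")
    case True
    then show ?thesis
      by (simp add: v_def letter_cones comb_def numeral_eq_Suc del: letter_elt.simps)
  next
    case False
    \<comment> \<open>After \<open>X1i\<close> the subtree \<open>b\<close> is at
      \<open>[True, True, False]\<close>; conjugation by \<open>X0\<close> moves it to
      \<open>[True, False]\<close>, where the induction hypothesis applies.\<close>
    have v: "v = X0i # trav_int b @ [X0, X1i]"
      using False by (simp add: v_def)
    have "maps_cone (eval v) [False] [False]"
      using cone_Nil[of "[False]", THEN X1i_0, THEN X0_0, THEN cone_append_0[OF _ Nd.IH(4)], THEN X0i_00]
      by (simp add: v)
    moreover have "maps_cone (eval v) [True, False, False] [True, False]"
      using cone_Nil[of "[True, False, False]", THEN X1i_100, THEN X0_10, THEN cone_append_0[OF _ Nd.IH(4)], THEN X0i_01]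
      by (simp add: v)
    moreover have "maps_cone (eval v) [True, True] (ones (carets b + 3))"
    proof -
      have "maps_cone (eval (trav_int b @ [X0, X1i])) [True, True] (True # ones (Suc (carets b)))"
        using cone_append[OF _ Nd.IH(5), where r="[]", simplified append_Nil2, OF cone_Nil[of "[True, True]", THEN X1i_11, THEN X0_11]]
        by simp
      from X0i_1[OF this] show ?thesis
        by (simp add: v numeral_eq_Suc)
    qed
    moreover have "maps_cones (eval v) (map ((@) [True, False, True]) (leaves b)) (map ((@) [True, True]) (comb (Suc (carets b))))"
    proof -
      have 1: "maps_cones (eval [X0, X1i]) (map ((@) [True, False, True]) (leaves b)) (map ((@) [True, False]) (leaves b))"
        using cone_Nil[of "[True, False, True]", THEN X1i_101, THEN X0_11] by (rule maps_cones_map)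
      have 2: "maps_cones (letter_elt X0i) (map ((@) [True]) (comb (Suc (carets b)))) (map ((@) [True, True]) (comb (Suc (carets b))))"
        using letter_cones(6) by (rule maps_cones_map)
      show ?thesis
        using maps_cones_comp[OF maps_cones_comp[OF 1 Nd.IH(6)] 2] by (simp only: v eval_append eval.simps comp_assoc append.simps)
    qed
    ultimately show ?thesis
      by blast
  qed
  note v = this[THEN conjunct1] this[THEN conjunct2, THEN conjunct1]
    this[THEN conjunct2, THEN conjunct2, THEN conjunct1] this[THEN conjunct2, THEN conjunct2, THEN conjunct2]
  {
    case 1
    show ?case
      using maps_cone_comp[OF v(1) Nd.IH(1)] by (simp only: split eval_append)
  next
    case 2
    have "maps_cone (eval (trav_int a)) (ones (carets b + 3)) (ones (Suc (Suc (carets (Nd a b)))))"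
    proof -
      have "ones (Suc (Suc (carets (Nd a b)))) = ones (Suc (Suc (carets a))) @ ones (Suc (carets b))"
        by (subst replicate_add[symmetric]) simp
      then show ?thesis
        using maps_cone_append[OF Nd.IH(2), of "ones (Suc (carets b))"] by (simp add: numeral_eq_Suc)
    qed
    then show ?case
      using maps_cone_comp[OF v(3)] by (simp only: split eval_append)
  next
    case 3
    have "maps_cones (eval (trav_int a)) (map ((@) [True, True]) (comb (Suc (carets b))))
       (map ((@) (ones (Suc (Suc (carets a))))) (comb (Suc (carets b))))"
      by (rule maps_cones_map[OF Nd.IH(2)])
    from maps_cones_comp[OF v(4) this]
    have "maps_cones (eval (trav_int (Nd a b))) (map ((@) [True, False, True]) (leaves b))
       (map ((@) (ones (Suc (Suc (carets a))))) (comb (Suc (carets b))))"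
      by (simp only: split eval_append)
    moreover have "maps_cones (eval (trav_int (Nd a b))) (map ((@) [True, False, False]) (leaves a))
       (map ((@) [True]) (comb (Suc (carets a))))"
      using maps_cones_comp[OF maps_cones_map[OF v(2)] Nd.IH(3)] by (simp only: split eval_append)
    moreover have eq: "map ((@) [True]) (comb (Suc (carets (Nd a b))))
      = map ((@) [True]) (comb (Suc (carets a))) @ map ((@) (ones (Suc (Suc (carets a))))) (comb (Suc (carets b)))"
      using comb_add[of "Suc (carets a)" "Suc (carets b)"] by simp
    ultimately show ?case
      unfolding eq by - (rule maps_cones_Nd, assumption, assumption, simp, simp)
  }
qed

lemmas trav_int_0 = cone_append_0[OF _ eval_trav_int(1)]

text \<open>A right subtree is flattened to a right vine. Unless \<open>b\<close> is one already,
  conjugation by \<open>X0\<close> first brings it from \<open>[True, True]\<close> to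
  \<open>[True]\<close>; then \<open>trav_int a\<close> unrolls \<open>a\<close>.\<close>

lemma eval_trav_right:
  "maps_cone (eval (trav_right t)) [False] [False]"
  "maps_cones (eval (trav_right t)) (map ((@) [True]) (leaves t)) (map ((@) [True]) (leaves (rvine (carets t))))"
proof (induction t)
  case Lf
  {
    case 1 show ?case by (simp add: maps_cone_def)
  next
    case 2 show ?case by (simp add: maps_cone_def)
  }
next
  case (Nd a b)
  define v where "v = (if is_rvine b then [] else X0i # trav_right b @ [X0])"
  have split: "trav_right (Nd a b) = trav_int a @ v"
    by (simp add: v_def)
  have "maps_cone (eval v) [False] [False] \<and> maps_cone (eval v) [True, False] [True, False] \<and>
    maps_cones (eval v) (map ((@) [True, True]) (leaves b)) (map ((@) [True, True]) (leaves (rvine (carets b))))"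
  proof (cases "is_rvine b")
    case True
    then have "b = rvine (carets b)"
      by (rule is_rvine_imp)
    moreover have "maps_cones id xs xs" for xs
      by (simp add: list_all2_refl)
    ultimately show ?thesis
      using True by (simp add: v_def cone_Nil)
  next
    case False
    have v: "v = X0i # trav_right b @ [X0]"
      using False by (simp add: v_def)
    have "maps_cone (eval v) [False] [False]"
      using cone_Nil[of "[False]", THEN X0_0, THEN cone_append_0[OF _ Nd.IH(3)], THEN X0i_00]
      by (simp add: v)
    moreover have "maps_cone (eval v) [True, False] [True, False]"
      using cone_Nil[of "[True, False]", THEN X0_10, THEN cone_append_0[OF _ Nd.IH(3)], THEN X0i_01]
      by (simp add: v)
    moreover have "maps_cones (eval v) (map ((@) [True, True]) (leaves b)) (map ((@) [True, True]) (leaves (rvine (carets b))))"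
    proof -
      have 1: "maps_cones (eval [X0]) (map ((@) [True, True]) (leaves b)) (map ((@) [True]) (leaves b))"
        using cone_Nil[of "[True, True]", THEN X0_11] by (rule maps_cones_map)
      have 2: "maps_cones (letter_elt X0i) (map ((@) [True]) xs) (map ((@) [True, True]) xs)" for xs
        using letter_cones(6) by (rule maps_cones_map)
      show ?thesis
        using maps_cones_comp[OF maps_cones_comp[OF 1 Nd.IH(4)] 2] by (simp only: v eval_append eval.simps comp_assoc append.simps)
    qed
    ultimately show ?thesis
      by blast
  qed
  note v = this[THEN conjunct1] this[THEN conjunct2, THEN conjunct1] this[THEN conjunct2, THEN conjunct2]
  {
    case 1
    show ?case
      using maps_cone_comp[OF v(1) eval_trav_int(1)] by (simp only: split eval_append)
  next
    case 2
    have "maps_cones (eval (trav_right (Nd a b))) (map ((@) [True, True]) (leaves b))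
       (map ((@) (ones (Suc (Suc (carets a))))) (leaves (rvine (carets b))))"
      using maps_cones_comp[OF v(3) maps_cones_map[OF eval_trav_int(2)]] by (simp only: split eval_append)
    moreover have "maps_cones (eval (trav_right (Nd a b))) (map ((@) [True, False]) (leaves a))
       (map ((@) [True]) (comb (Suc (carets a))))"
      using maps_cones_comp[OF maps_cones_map[OF v(2)] eval_trav_int(3)] by (simp only: split eval_append)
    moreover have eq: "map ((@) [True]) (leaves (rvine (carets (Nd a b))))
      = map ((@) [True]) (comb (Suc (carets a))) @ map ((@) (ones (Suc (Suc (carets a))))) (leaves (rvine (carets b)))"
      using leaves_rvine_add[of "Suc (carets a)" "carets b"] by (simp del: rvine.simps)
    ultimately show ?case
      unfolding eq by - (rule maps_cones_Nd, assumption, assumption, simp, simp)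
  }
qed

lemmas trav_right_0 = cone_append_0[OF _ eval_trav_right(1)]

text \<open>The word of a left subtree together with the letter \<open>X0i\<close> of the caret
  above it. With this shift the recursion along the left side needs no special case for the first
  caret.\<close>

definition trav_spine :: "tree \<Rightarrow> letter list" where
  "trav_spine t = (if t = Lf then [] else trav_left t @ [X0i])"

lemma trav_spine_simps [simp]:
  "trav_spine Lf = []"
  "trav_spine (Nd a b) = trav_spine a @ trav_int b @ [X0i]"
  by (simp_all add: trav_spine_def)

lemma gamma_Nd: "gamma (Nd l r) = trav_spine l @ trav_right r"
  by (simp add: trav_spine_def)

text \<open>The last letter \<open>X0i\<close> acts first and rotates the root of \<open>t\<close>
  from \<open>[False]\<close> onto the right side; then \<open>b\<close> is unrolled at
  \<open>[True, False]\<close>, and the rest of the left side follows.\<close>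

lemma eval_trav_spine:
  "maps_cone (eval (trav_spine t)) [True] (ones (Suc (carets t)))"
  "maps_cones (eval (trav_spine t)) (map ((@) [False]) (leaves t)) (comb (Suc (carets t)))"
proof (induction t)
  case Lf
  {
    case 1 show ?case by (simp add: maps_cone_def)
  next
    case 2 show ?case by (simp add: maps_cone_def comb_def)
  }
next
  case (Nd a b)
  let ?v = "trav_int b @ [X0i]"
  {
    case 1
    have "maps_cone (eval ?v) [True] (ones (Suc (Suc (carets b))))"
      using cone_Nil[of "[True]", THEN X0i_1, THEN cone_append[where r="[]", simplified, OF _ eval_trav_int(2)]]
      by simp
    moreover have "maps_cone (eval (trav_spine a)) (ones (Suc (Suc (carets b)))) (ones (Suc (carets (Nd a b))))"
    proof -
      have "ones (Suc (carets (Nd a b))) = ones (Suc (carets a)) @ ones (Suc (carets b))"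
        by (subst replicate_add[symmetric]) simp
      then show ?thesis
        using maps_cone_append[OF Nd.IH(1), of "ones (Suc (carets b))"] by simp
    qed
    ultimately show ?case
      unfolding trav_spine_simps by (subst eval_append) (rule maps_cone_comp)
  next
    case 2
    have "maps_cone (eval ?v) [False, False] [False]"
      using cone_Nil[of "[False, False]", THEN X0i_00, THEN trav_int_0, of b] .
    then have "maps_cones (eval (trav_spine (Nd a b))) (map ((@) [False, False]) (leaves a)) (comb (Suc (carets a)))"
      using maps_cones_comp[OF maps_cones_map Nd.IH(2)] by (simp only: trav_spine_simps eval_append)
    moreover
    have "maps_cones (eval [X0i]) (map ((@) [False, True]) (leaves b)) (map ((@) [True, False]) (leaves b))"
      using cone_Nil[of "[False, True]", THEN X0i_01] by (rule maps_cones_map)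
    from maps_cones_comp[OF maps_cones_comp[OF this eval_trav_int(3)] maps_cones_map[OF Nd.IH(1)]]
    have "maps_cones (eval (trav_spine (Nd a b))) (map ((@) [False, True]) (leaves b))
       (map ((@) (ones (Suc (carets a)))) (comb (Suc (carets b))))"
      by (simp only: trav_spine_simps eval_append comp_assoc)
    moreover have eq: "comb (Suc (carets (Nd a b)))
      = comb (Suc (carets a)) @ map ((@) (ones (Suc (carets a)))) (comb (Suc (carets b)))"
      using comb_add[of "Suc (carets a)" "Suc (carets b)"] by simp
    ultimately show ?case
      unfolding eq by - (rule maps_cones_Nd, assumption, assumption, simp, simp)
  }
qed

lemma represents_gamma: "represents T (rvine (carets T)) (eval (gamma T))"
proof (cases T)
  case Lf
  then show ?thesis by (simp add: represents_id del: id_apply)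
next
  case (Nd l r)
  have "maps_cones (eval (gamma T)) (map ((@) [False]) (leaves l)) (comb (Suc (carets l)))"
    using maps_cones_comp[OF maps_cones_map[OF eval_trav_right(1)] eval_trav_spine(2)]
    by (simp only: Nd gamma_Nd eval_append)
  moreover have "maps_cones (eval (gamma T)) (map ((@) [True]) (leaves r))
    (map ((@) (ones (Suc (carets l)))) (leaves (rvine (carets r))))"
    using maps_cones_comp[OF eval_trav_right(2) maps_cones_map[OF eval_trav_spine(1)]]
    by (simp only: Nd gamma_Nd eval_append)
  moreover have eq: "leaves (rvine (carets T)) = comb (Suc (carets l)) @ map ((@) (ones (Suc (carets l)))) (leaves (rvine (carets r)))"
    using leaves_rvine_add[of "Suc (carets l)" "carets r"] by (simp add: Nd del: rvine.simps leaves.simps add_Suc) simp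
  ultimately have "maps_cones (eval (gamma T)) (map ((@) []) (leaves T)) (leaves (rvine (carets T)))"
    unfolding eq unfolding Nd by - (rule maps_cones_Nd, assumption, assumption, simp, simp)
  then show ?thesis
    by (simp add: represents_def map_idI)
qed

section \<open>Rotations along a traversal word\<close>

lemma prepend_const: "set p \<subseteq> {b} \<Longrightarrow> prepend p (\<lambda>_. b) = (\<lambda>_. b)"
  using nth_mem by (fastforce simp: prepend_def fun_eq_iff)

text \<open>The constant words are the end points of the interval, fixed by every element of the
  group.\<close>

lemma letter_elt_const: "letter_elt a (\<lambda>_. b) = (\<lambda>_. b)"
proof -
  have X1: "maps_cone (letter_elt X1) [False] [False]" "maps_cone (letter_elt X1) [True, True, True] [True, True]"
    using letter_cones(7,10) maps_cone_inverse[OF letter_elt_inverse[of X1i]] by (simp_all del: letter_elt.simps)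
  show ?thesis
    using letter_cones(3,6,10)[THEN maps_coneD, of "\<lambda>_. True"] X1[THEN maps_coneD, of "\<lambda>_. True"]
      letter_cones(1,4,7)[THEN maps_coneD, of "\<lambda>_. False"] X1[THEN maps_coneD, of "\<lambda>_. False"]
    by (cases a; cases b) (simp_all add: prepend_const del: letter_elt.simps)
qed

lemma eval_const: "eval u (\<lambda>_. b) = (\<lambda>_. b)"
  by (induction u) (simp_all add: letter_elt_const)

lemma eval_maps_cone_inj: "maps_cone (eval u) p q \<Longrightarrow> maps_cone (eval u) p' q \<Longrightarrow> p = p'"
  using maps_cone_inj[OF inj_eval] .

text \<open>Here \<open>a\<close> is a letter of \<open>u @ a # v = gamma T\<close> and \<open>I = inner T\<close>. The first conjunct
  makes the number of carets monotone when the suffix \<open>v\<close> is extended to the left, the second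
  when the prefix \<open>u\<close> is extended to the right, except along the initial run of \<open>X0i\<close>.\<close>

definition grows :: "bool list set \<Rightarrow> letter list \<Rightarrow> letter \<Rightarrow> letter list \<Rightarrow> bool" where
  "grows I u a v \<longleftrightarrow> (\<nexists>q. maps_cone (eval (a # v)) q (loc a)) \<and>
     ((\<exists>p \<in> I. \<exists>r. maps_cone (eval v) p (loc (inv_letter a) @ r)) \<or> a = X0i \<and> set u \<subseteq> {X0i})"

fun grows_word :: "bool list set \<Rightarrow> letter list \<Rightarrow> letter list \<Rightarrow> letter list \<Rightarrow> bool" where
  "grows_word I u [] v = True"
| "grows_word I u (a # w) v = (grows I u a (w @ v) \<and> grows_word I (u @ [a]) w v)"

lemma grows_word_append:
  "grows_word I u (w @ w') v \<longleftrightarrow> grows_word I u w (w' @ v) \<and> grows_word I (u @ w) w' v"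
  by (induction w arbitrary: u) auto

text \<open>The second conjunct of \<open>grows\<close> for the letter \<open>X0i\<close>, as
  \<open>loc X0 = [False]\<close>. It is handed down the recursion because an \<open>X0i\<close>
  opening a conjugation may have to rely on a caret outside the current subtree.\<close>

definition anchored :: "bool list set \<Rightarrow> letter list \<Rightarrow> letter list \<Rightarrow> bool" where
  "anchored I u v \<longleftrightarrow> (\<exists>p \<in> I. \<exists>r. maps_cone (eval v) p (False # r)) \<or> set u \<subseteq> {X0i}"

text \<open>The caret \<open>p\<close> sits at \<open>loc X1\<close>, which gives the second
  conjunct. \<open>X1i\<close> sends the right half of \<open>p\<close> to the left half of
  \<open>loc X1i\<close>, so a cone sent onto \<open>loc X1i\<close> would have a right half as its
  left half. The same argument gives \<open>grows_X0i\<close>.\<close>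

lemma grows_X1i:
  assumes "maps_cone (eval v) p [True, False]" "p \<in> I"
  shows "grows I u X1i v"
proof -
  have 1: "maps_cone (eval (X1i # v)) (p @ [True]) [True, True, False]"
    using maps_cone_append[OF assms(1), of "[True]", unfolded append.simps, THEN X1i_101] .
  have "\<not> maps_cone (eval (X1i # v)) q [True, True]" for q
    using maps_cone_append[of _ q "[True, True]" "[False]", unfolded append.simps] eval_maps_cone_inj[OF 1] by blast
  then show ?thesis
    using assms by (auto simp: grows_def loc_def intro: exI[of _ "[]"] simp del: eval.simps)
qed

lemma grows_X0i:
  assumes "maps_cone (eval v) p [False]" "p \<in> I"
  shows "grows I u X0i v"
proof -
  have 1: "maps_cone (eval (X0i # v)) (p @ [True]) [True, False]"
    using maps_cone_append[OF assms(1), of "[True]", unfolded append.simps, THEN X0i_01] .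
  have "\<not> maps_cone (eval (X0i # v)) q [True]" for q
    using maps_cone_append[of _ q "[True]" "[False]", unfolded append.simps] eval_maps_cone_inj[OF 1] by blast
  then show ?thesis
    using assms by (auto simp: grows_def loc_def intro: exI[of _ "[]"] simp del: eval.simps)
qed

text \<open>For an \<open>X0i\<close> that opens a conjugation. The left half of \<open>p\<close>
  goes to the left half of \<open>loc X0i\<close>, so only \<open>p\<close> could be sent onto
  \<open>loc X0i\<close>, which the second premise excludes.\<close>

lemma grows_X0i_anchored:
  assumes "maps_cone (eval (X0i # v)) (p @ [False]) [True, False]"
    and "\<not> maps_cone (eval (X0i # v)) p [True]" "anchored I u v"
  shows "grows I u X0i v"
proof -
  have "\<not> maps_cone (eval (X0i # v)) q [True]" for q
  proof
    assume q: "maps_cone (eval (X0i # v)) q [True]"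
    then have "q @ [False] = p @ [False]"
      using maps_cone_append[of _ q "[True]" "[False]", unfolded append.simps] eval_maps_cone_inj[OF _ assms(1)] by blast
    then show False
      using q assms(2) by simp
  qed
  then show ?thesis
    using assms(3) by (simp add: grows_def loc_def anchored_def del: eval.simps)
qed

text \<open>For an \<open>X0\<close> that closes a conjugation. The left half of \<open>p\<close>
  goes to the right half of \<open>loc X0\<close>, so no cone goes onto \<open>loc X0\<close>; the
  caret \<open>p @ [True]\<close> is sent by \<open>v\<close> into the cone of
  \<open>loc X0i\<close>.\<close>

lemma grows_X0:
  assumes "maps_cone (eval (X0 # v)) (p @ [False]) [False, True]"
    and "maps_cone (eval v) (p @ [True]) (True # r)" "p @ [True] \<in> I"
  shows "grows I u X0 v"
proof -
  have "\<not> maps_cone (eval (X0 # v)) q [False]" for q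
    using maps_cone_append[of _ q "[False]" "[True]", unfolded append.simps] eval_maps_cone_inj[OF assms(1)] by blast
  then show ?thesis
    using assms(2,3) by (auto simp: grows_def loc_def simp del: eval.simps)
qed

lemma anchoredI: "maps_cone (eval v) p (False # r) \<Longrightarrow> p \<in> I \<Longrightarrow> anchored I u v"
  by (auto simp: anchored_def)

text \<open>The subtree \<open>t\<close> sits at \<open>p\<close>, and \<open>v\<close>, acting
  earlier, has brought it to \<open>[True, False]\<close>. Following its cones through the word
  locates each caret when its letter acts.\<close>

lemma grows_trav_int:
  assumes "\<forall>x \<in> inner t. p @ x \<in> I" "maps_cone (eval v) p [True, False]" "anchored I u v"
  shows "grows_word I u (trav_int t) v"
  using assms
proof (induction t arbitrary: p u v)
  case (Nd a b)
  have I: "p \<in> I" "\<forall>x \<in> inner a. (p @ [False]) @ x \<in> I" "\<forall>x \<in> inner b. (p @ [True]) @ x \<in> I"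
    using Nd.prems(1) by auto
  note p0 = maps_cone_append[OF Nd.prems(2), of "[False]", unfolded append.simps, THEN X1i_100]
  note p1 = maps_cone_append[OF Nd.prems(2), of "[True]", unfolded append.simps, THEN X1i_101]
  have X1i: "grows I u' X1i v" for u'
    using grows_X1i Nd.prems(2) I(1) .
  show ?case
  proof (cases "b = Lf")
    case True
    have "anchored I u (X1i # v)"
      using Nd.prems(3) X1i_0 by (fastforce simp: anchored_def simp del: eval.simps)
    then show ?thesis
      using True X1i Nd.IH(1)[OF I(2) p0] by (simp add: grows_word_append del: eval.simps)
  next
    case False
    note p0' = p0[THEN X0_10] and p1' = p1[THEN X0_11]
    let ?v = "X0 # X1i # v"
    note p0'' = p0'[THEN trav_int_0, of b]
    note p0''' = p0''[THEN X0i_01]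
    \<comment> \<open>\<open>X1i\<close> and \<open>X0\<close> keep everything below
      \<open>[False]\<close> there, so an anchor for \<open>v\<close> is one for
      \<open>?v\<close>.\<close>
    have pass: "maps_cone (eval v) q (False # r) \<Longrightarrow> maps_cone (eval ?v) q (False # False # r)" for q r
      by (intro X0_0 X1i_0)
    have "anchored I u (X0i # trav_int b @ ?v)"
      using Nd.prems(3) pass[THEN trav_int_0, of _ _ b, THEN X0i_00] by (fastforce simp: anchored_def simp del: eval.simps)
    then have a: "grows_word I u (trav_int a) (X0i # trav_int b @ ?v)"
      using Nd.IH(1)[OF I(2) p0'''] by simp
    \<comment> \<open>If \<open>a\<close> is a leaf, the anchor is inherited; otherwise the root of
      \<open>a\<close> is one.\<close>
    have anchored: "anchored I (u @ trav_int a @ [X0i]) ?v \<and> anchored I (u @ trav_int a) (trav_int b @ ?v)"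
    proof (cases "a = Lf")
      case True
      then show ?thesis
        using Nd.prems(3) pass pass[THEN trav_int_0, of _ _ b] by (fastforce simp: anchored_def simp del: eval.simps)
    next
      case False
      then have "p @ [False] \<in> I"
        using I(2) by (cases a) auto
      then show ?thesis
        using p0' p0'' anchoredI by blast
    qed
    have b: "grows_word I (u @ trav_int a @ [X0i]) (trav_int b) ?v"
      using Nd.IH(2)[OF I(3) p1'] anchored by simp
    have "p @ [True] \<in> I"
      using False I(3) by (cases b) auto
    then have X0: "grows I u' X0 (X1i # v)" for u'
      using grows_X0[OF p0' p1] by simp
    \<comment> \<open>A cone sent onto \<open>[True]\<close> contains the fixed constant word of
      \<open>True\<close>; but \<open>v\<close> sends the cone of \<open>p\<close> onto that of
      \<open>[True, False]\<close>, which does not.\<close>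
    have "\<not> maps_cone (eval (X0i # trav_int b @ ?v)) p [True]"
    proof
      assume "maps_cone (eval (X0i # trav_int b @ ?v)) p [True]"
      then have "eval (X0i # trav_int b @ ?v) (prepend p (\<lambda>_. True)) = eval (X0i # trav_int b @ ?v) (\<lambda>_. True)"
        by (subst eval_const) (simp only: maps_coneD, simp add: prepend_const)
      then have "prepend p (\<lambda>_. True) = (\<lambda>_. True)"
        using inj_eval injD by metis
      then have "prepend [True, False] (\<lambda>_. True) = (\<lambda>_. True)"
        using maps_coneD[OF Nd.prems(2), of "\<lambda>_. True"] by (simp add: eval_const)
      then show False
        by (metis One_nat_def prepend_Cons_nth)
    qed
    then have "grows I (u @ trav_int a) X0i (trav_int b @ ?v)"
      using grows_X0i_anchored p0''' anchored by blast
    then show ?thesis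
      using False a b X0 X1i by (simp add: grows_word_append del: eval.simps)
  qed
qed simp

lemma grows_trav_right:
  assumes "\<forall>x \<in> inner t. p @ x \<in> I" "maps_cone (eval v) p [True]" "anchored I u v"
  shows "grows_word I u (trav_right t) v"
  using assms
proof (induction t arbitrary: p u v)
  case (Nd a b)
  have I: "\<forall>x \<in> inner a. (p @ [False]) @ x \<in> I" "\<forall>x \<in> inner b. (p @ [True]) @ x \<in> I"
    using Nd.prems(1) by auto
  note p0 = maps_cone_append[OF Nd.prems(2), of "[False]", unfolded append.simps]
  note p1 = maps_cone_append[OF Nd.prems(2), of "[True]", unfolded append.simps]
  show ?case
  proof (cases "is_rvine b")
    case True
    then show ?thesis
      using grows_trav_int[OF I(1) p0 Nd.prems(3)] by simp
  next
    case False
    let ?v = "X0 # v"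
    note p0' = p0[THEN X0_10] and p1' = p1[THEN X0_11]
    note p0'' = p0'[THEN trav_right_0, of b]
    note p0''' = p0''[THEN X0i_01]
    have "anchored I u (X0i # trav_right b @ ?v)"
      using Nd.prems(3) X0_0[THEN trav_right_0, of _ _ _ b, THEN X0i_00] by (fastforce simp: anchored_def simp del: eval.simps)
    then have a: "grows_word I u (trav_int a) (X0i # trav_right b @ ?v)"
      using grows_trav_int[OF I(1) p0'''] by simp
    have anchored: "anchored I (u @ trav_int a @ [X0i]) ?v \<and> anchored I (u @ trav_int a) (trav_right b @ ?v)"
    proof (cases "a = Lf")
      case True
      then show ?thesis
        using Nd.prems(3) X0_0 X0_0[THEN trav_right_0, of _ _ _ b] by (fastforce simp: anchored_def simp del: eval.simps)
    next
      case False
      then have "p @ [False] \<in> I"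
        using I(1) by (cases a) auto
      then show ?thesis
        using p0' p0'' anchoredI by blast
    qed
    have b: "grows_word I (u @ trav_int a @ [X0i]) (trav_right b) ?v"
      using Nd.IH(2)[OF I(2) p1'] anchored by simp
    have "p @ [True] \<in> I"
      using False I(2) by (cases b) auto
    then have X0: "grows I u' X0 v" for u'
      using grows_X0[OF p0' p1] by simp
    \<comment> \<open>Here the end points give no contradiction. Undoing \<open>X0i\<close>, the
      cone of \<open>p @ [True]\<close> would go onto \<open>[True]\<close> as a whole, while
      \<open>trav_right b\<close> flattens \<open>b\<close> there; so \<open>b\<close> would already
      be a right vine, which the traversal skips.\<close>
    have "\<not> maps_cone (eval (X0i # trav_right b @ ?v)) p [True]"
    proof
      assume "maps_cone (eval (X0i # trav_right b @ ?v)) p [True]"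
      from maps_cone_append[OF this, of "[True]", unfolded append.simps, THEN X0_11]
      have "maps_cone (letter_elt X0 \<circ> letter_elt X0i \<circ> eval (trav_right b @ ?v)) (p @ [True]) [True]"
        by (simp only: eval.simps comp_assoc)
      then have 1: "maps_cone (eval (trav_right b @ ?v)) (p @ [True]) [True]"
        using letter_elt_inverse[of X0i] by (simp only: inv_letter.simps id_comp)
      have "maps_cones (eval (trav_right b @ ?v)) (map ((@) (p @ [True])) (leaves b)) (map ((@) [True]) (leaves (rvine (carets b))))"
        using maps_cones_comp[OF maps_cones_map[OF p1'] eval_trav_right(2)] by (simp only: eval_append)
      then have 2: "maps_cone (eval (trav_right b @ ?v)) ((p @ [True]) @ leaves b ! i) ([True] @ leaves (rvine (carets b)) ! i)"
        if "i \<le> carets b" for i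
        using that by (simp add: list_all2_conv_all_nth del: eval.simps)
      have "leaves b ! i = leaves (rvine (carets b)) ! i" if "i \<le> carets b" for i
        using maps_cone_unique[OF maps_cone_append[OF 1, of "leaves b ! i"] 2[OF that]] by simp
      then have "leaves b = leaves (rvine (carets b))"
        by (intro nth_equalityI) auto
      then show False
        using False leaves_inject is_rvine_rvine by metis
    qed
    then have "grows I (u @ trav_int a) X0i (trav_right b @ ?v)"
      using grows_X0i_anchored p0''' anchored by blast
    then show ?thesis
      using False a b X0 by (simp add: grows_word_append del: eval.simps)
  qed
qed simp

text \<open>This part begins the word, hence the empty \<open>u\<close>. The subword
  \<open>trav_int b\<close> is anchored by the root of \<open>a\<close> or, if \<open>a\<close> is a
  leaf, because nothing precedes it.\<close>

lemma grows_trav_spine: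
  assumes "\<forall>x \<in> inner t. p @ x \<in> I" "maps_cone (eval v) p [False]"
  shows "grows_word I [] (trav_spine t) v"
  using assms
proof (induction t arbitrary: p v)
  case (Nd a b)
  have I: "p \<in> I" "\<forall>x \<in> inner a. (p @ [False]) @ x \<in> I" "\<forall>x \<in> inner b. (p @ [True]) @ x \<in> I"
    using Nd.prems(1) by auto
  note p0 = maps_cone_append[OF Nd.prems(2), of "[False]", unfolded append.simps, THEN X0i_00]
  note p1 = maps_cone_append[OF Nd.prems(2), of "[True]", unfolded append.simps, THEN X0i_01]
  have a: "grows_word I [] (trav_spine a) (trav_int b @ X0i # v)"
    using Nd.IH(1)[OF I(2) p0[THEN trav_int_0, of b]] .
  have "anchored I (trav_spine a) (X0i # v)"
  proof (cases "a = Lf")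
    case True
    then show ?thesis by (simp add: anchored_def)
  next
    case False
    then have "p @ [False] \<in> I"
      using I(2) by (cases a) auto
    then show ?thesis
      using p0 anchoredI by blast
  qed
  then have "grows_word I (trav_spine a) (trav_int b) (X0i # v)"
    using grows_trav_int[OF I(3) p1] by simp
  then show ?case
    using a grows_X0i[OF Nd.prems(2) I(1)] by (simp add: grows_word_append del: eval.simps)
qed simp

lemma grows_gamma: "grows_word (inner T) [] (gamma T) []"
proof (cases T)
  case (Nd l r)
  have "grows_word (inner T) [] (trav_spine l) (trav_right r)"
    using eval_trav_right(1) by (intro grows_trav_spine[of _ "[False]"]) (auto simp: Nd)
  moreover have "anchored (inner T) (trav_spine l) []"
  proof (cases "l = Lf")
    case False
    then have "[False] \<in> inner T"
      using Nd by (cases l) auto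
    then show ?thesis
      using cone_Nil anchoredI by blast
  qed (simp add: anchored_def)
  then have "grows_word (inner T) (trav_spine l) (trav_right r) []"
    using cone_Nil by (intro grows_trav_right[of _ "[True]"]) (auto simp: Nd)
  ultimately show ?thesis
    by (simp add: Nd gamma_Nd grows_word_append del: gamma.simps)
qed simp

lemma grows_gammaD: "gamma T = u @ a # v \<Longrightarrow> grows (inner T) u a v"
  using grows_gamma[of T] by (simp add: grows_word_append)

section \<open>Free reduction and the initial run\<close>

definition no_cancel :: "letter \<Rightarrow> letter \<Rightarrow> bool" where
  "no_cancel a b \<longleftrightarrow> b \<noteq> inv_letter a"

lemma no_cancel_inv: "no_cancel (inv_letter a) (inv_letter b) \<longleftrightarrow> no_cancel b a"
  by (cases a; cases b) (auto simp: no_cancel_def)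

lemma free_red_id: "successively no_cancel u \<Longrightarrow> free_red u = u"
  by (induction u) (auto simp: successively_Cons no_cancel_def split: list.split)

lemma free_red_append_cong: "free_red v = free_red v' \<Longrightarrow> free_red (u @ v) = free_red (u @ v')"
  by (induction u) auto

lemma free_red_cancel:
  "successively no_cancel (p @ v) \<Longrightarrow> free_red (inv_word p @ p @ v) = v"
proof (induction p)
  case Nil
  then show ?case by (simp add: free_red_id)
next
  case (Cons a p)
  have "successively no_cancel (p @ v)"
    using Cons.prems by (cases "p @ v") (auto simp: successively_Cons)
  moreover have "free_red ([inv_letter a] @ (a # p) @ v) = p @ v"
    using free_red_id[OF Cons.prems] by simp
  ultimately have "free_red ([inv_letter a] @ (a # p) @ v) = free_red (p @ v)"
    by (simp only: free_red_id)
  then have "free_red (inv_word p @ [inv_letter a] @ (a # p) @ v) = free_red (inv_word p @ p @ v)"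
    by (rule free_red_append_cong)
  then show ?case
    using Cons.IH \<open>successively no_cancel (p @ v)\<close> by (simp del: free_red.simps)
qed

lemma successively_inv_word: "successively no_cancel u \<Longrightarrow> successively no_cancel (inv_word u)"
  by (simp add: inv_word_def successively_map no_cancel_inv)

text \<open>Once \<open>p\<close> has cancelled, the letters meeting at the junction are the inverse
  of \<open>hd u\<close> and \<open>hd v\<close>, and these do not cancel.\<close>

lemma free_red_common_prefix:
  assumes "successively no_cancel (p @ u)" "successively no_cancel (p @ v)"
    and "u = [] \<or> v = [] \<or> hd u \<noteq> hd v"
  shows "free_red (inv_word (p @ u) @ p @ v) = inv_word u @ v"
proof -
  have "successively no_cancel (inv_word u)" "successively no_cancel v"
    using assms successively_inv_word by (auto simp: successively_append_iff)
  moreover have "u \<noteq> [] \<Longrightarrow> last (inv_word u) = inv_letter (hd u)"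
    by (cases u) auto
  ultimately have red: "successively no_cancel (inv_word u @ v)"
    using assms(3) by (auto simp: successively_append_iff no_cancel_def inv_word_def)
  have "free_red (inv_word p @ p @ v) = free_red v"
    using free_red_cancel[OF assms(2)] free_red_id \<open>successively no_cancel v\<close> by simp
  then have "free_red (inv_word u @ inv_word p @ p @ v) = free_red (inv_word u @ v)"
    by (rule free_red_append_cong)
  then show ?thesis
    using free_red_id[OF red] by simp
qed

text \<open>First and last letters are recorded because they decide what cancels where pieces are
  joined.\<close>

lemma trav_int_reduced:
  "t \<noteq> Lf \<Longrightarrow> successively no_cancel (trav_int t) \<and> trav_int t \<noteq> [] \<and>
     hd (trav_int t) \<in> {X0i, X1i} \<and> last (trav_int t) = X1i"
proof (induction t)
  case (Nd a b)
  then show ?case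
    by (cases "a = Lf"; cases "b = Lf")
      (auto simp: successively_append_iff successively_Cons no_cancel_def)
qed simp

text \<open>With an empty word between them the conjugating \<open>X0i\<close> and \<open>X0\<close>
  would cancel; the traversal omits them in exactly this case.\<close>

lemma trav_right_reduced:
  "if is_rvine t then trav_right t = []
   else successively no_cancel (trav_right t) \<and> trav_right t \<noteq> [] \<and>
     hd (trav_right t) \<in> {X0i, X1i} \<and> last (trav_right t) \<in> {X0, X1i}"
proof (induction t)
  case (Nd a b)
  then show ?case
    using trav_int_reduced[of a]
    by (cases "a = Lf"; cases "is_rvine b")
      (auto simp: successively_append_iff successively_Cons no_cancel_def)
qed simp

lemma trav_spine_reduced:
  "t \<noteq> Lf \<Longrightarrow> successively no_cancel (trav_spine t) \<and> trav_spine t \<noteq> [] \<and>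
     hd (trav_spine t) \<in> {X0i, X1i} \<and> last (trav_spine t) = X0i"
proof (induction t)
  case (Nd a b)
  then show ?case
    using trav_int_reduced[of b]
    by (cases "a = Lf"; cases "b = Lf")
      (auto simp: successively_append_iff successively_Cons no_cancel_def)
qed simp

lemma gamma_reduced: "successively no_cancel (gamma T)"
proof (cases T)
  case (Nd l r)
  then show ?thesis
    using trav_spine_reduced[of l] trav_right_reduced[of r]
    by (cases "l = Lf"; cases "is_rvine r")
      (auto simp: gamma_Nd successively_append_iff no_cancel_def simp del: gamma.simps)
qed simp

lemma count_trav_int: "count_list (trav_int t) X0i \<le> carets t"
  by (induction t) auto

lemma count_trav_right: "count_list (trav_right t) X0i \<le> carets t"
proof (induction t)
  case (Nd a b)
  then show ?case
    using count_trav_int[of a] by auto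
qed simp

lemma count_trav_spine: "count_list (trav_spine t) X0i \<le> carets t"
proof (induction t)
  case (Nd a b)
  then show ?case
    using count_trav_int[of b] by simp
qed simp

text \<open>The two subtrees account for all letters \<open>X0i\<close>, at most one per caret, and
  the root is left over. This bounds the initial run.\<close>

lemma count_gamma: "gamma T \<noteq> [] \<Longrightarrow> count_list (gamma T) X0i < carets T"
  using count_trav_spine count_trav_right
  by (cases T) (auto simp: gamma_Nd less_Suc_eq_le intro: add_mono simp del: gamma.simps(2))

section \<open>Left vines and the initial run of \<open>X0i\<close>\<close>

fun lvine :: "nat \<Rightarrow> tree" where
  "lvine 0 = Lf"
| "lvine (Suc n) = Nd (lvine n) Lf"

lemma carets_lvine [simp]: "carets (lvine n) = n"
  by (induction n) auto

lemma trav_spine_lvine: "trav_spine (lvine n) = replicate n X0i"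
  by (induction n) (simp_all add: replicate_append_same)

text \<open>The cones of the leaves of \<open>S\<close> already cover all words, leaving no room for
  further leaves of \<open>T\<close>.\<close>

lemma leaves_subset_eq: "set (leaves S) \<subseteq> set (leaves T) \<Longrightarrow> S = T"
proof (induction S arbitrary: T)
  case (Nd l r)
  then obtain l' r' where T: "T = Nd l' r'"
  proof (cases T)
    case Lf
    obtain p where "p \<in> set (leaves l)"
      using leaves_nonempty by (meson ex_in_conv set_empty)
    then show ?thesis
      using Nd.prems Lf by auto
  qed
  then have "set (leaves l) \<subseteq> set (leaves l')" "set (leaves r) \<subseteq> set (leaves r')"
    using Nd.prems by auto
  then show ?case
    using Nd.IH T by simp
qed simp

text \<open>The hypothesis says that the subtree of \<open>T\<close> at depth \<open>j\<close> on
  the left side is \<open>lvine m\<close>; its letters come first.\<close>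

lemma trav_spine_vine_below:
  "(\<forall>x \<in> set (leaves (lvine m)). replicate j False @ x \<in> set (leaves T)) \<Longrightarrow>
    \<exists>u. trav_spine T = replicate m X0i @ u"
proof (induction j arbitrary: T)
  case 0
  then have "lvine m = T"
    by (intro leaves_subset_eq) auto
  then show ?case
    using trav_spine_lvine by auto
next
  case (Suc j)
  obtain x where "x \<in> set (leaves (lvine m))"
    using leaves_nonempty by (meson ex_in_conv set_empty)
  then obtain l r where T: "T = Nd l r"
    using Suc.prems by (cases T) auto
  then have "\<forall>x \<in> set (leaves (lvine m)). replicate j False @ x \<in> set (leaves l)"
    using Suc.prems by auto
  then show ?case
    using Suc.IH T by fastforce
qed

lemma gamma_vine_below:
  assumes "\<forall>x \<in> set (leaves (lvine m)). replicate j False @ x \<in> set (leaves T)" "m < carets T"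
  shows "\<exists>u. gamma T = replicate m X0i @ u"
proof -
  obtain l r where T: "T = Nd l r"
    using assms(2) by (cases T) auto
  \<comment> \<open>For \<open>j = 0\<close> the whole tree would be \<open>lvine m\<close>, which
    has too few carets; so the vine lies in the left subtree of the root.\<close>
  have "j \<noteq> 0"
  proof
    assume "j = 0"
    then have "lvine m = T"
      using assms(1) by (intro leaves_subset_eq) auto
    then show False
      using assms(2) by auto
  qed
  then obtain j' where "j = Suc j'"
    using not0_implies_Suc by blast
  then have "\<forall>x \<in> set (leaves (lvine m)). replicate j' False @ x \<in> set (leaves l)"
    using assms(1) T by auto
  then show ?thesis
    using trav_spine_vine_below[of m j' l] by (auto simp: T gamma_Nd simp del: gamma.simps)
qed

text \<open>\<open>X0i ^ m\<close> unrolls a left vine at \<open>[False]\<close> onto the first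
  \<open>m + 1\<close> leaves of the right vine, and the inverse of \<open>gamma T\<close> sends
  these to leaves of \<open>T\<close>. If the cone of \<open>[False]\<close> stays intact, this vine
  is a subtree of \<open>T\<close> at \<open>q\<close>, on the left side because the constant word
  of \<open>False\<close> is fixed.\<close>

lemma initial_run:
  assumes "m < carets T" "maps_cone (eval (inv_word (gamma T) @ replicate m X0i)) [False] q"
  shows "\<exists>u. gamma T = replicate m X0i @ u"
proof (rule gamma_vine_below[OF _ assms(1)])
  let ?h = "eval (inv_word (gamma T) @ replicate m X0i)"
  have "prepend q (\<lambda>_. False) = (\<lambda>_. False)"
    using maps_coneD[OF assms(2), of "\<lambda>_. False"] by (simp add: prepend_const eval_const)
  then have "q ! k = False" if "k < length q" for k
    using that by (metis prepend_def)
  then have q: "q = replicate (length q) False"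
    by (intro nth_equalityI) auto
  show "\<forall>x \<in> set (leaves (lvine m)). replicate (length q) False @ x \<in> set (leaves T)"
  proof
    fix x
    assume "x \<in> set (leaves (lvine m))"
    then obtain i where i: "i \<le> m" "x = leaves (lvine m) ! i"
      by (auto simp: in_set_conv_nth less_Suc_eq_le)
    have "maps_cone (eval (replicate m X0i)) ([False] @ x) (comb (Suc m) ! i)"
      using eval_trav_spine(2)[of "lvine m"] i
      by (simp add: trav_spine_lvine list_all2_conv_all_nth)
    \<comment> \<open>\<open>m < carets T\<close> keeps \<open>i\<close> short of the last leaf,
      which is not in the comb.\<close>
    moreover have "comb (Suc m) ! i = leaves (rvine (carets T)) ! i"
      using i assms(1) by (simp add: leaves_rvine nth_append comb_def del: upt_Suc)
    moreover have "maps_cone (eval (inv_word (gamma T))) (leaves (rvine (carets T)) ! i) (leaves T ! i)"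
      using represents_nth[OF represents_gamma, of i T] i assms(1) by (simp add: maps_cone_inv_word)
    ultimately have "maps_cone ?h ([False] @ x) (leaves T ! i)"
      unfolding eval_append by (metis maps_cone_comp)
    then have "q @ x = leaves T ! i"
      using maps_cone_unique maps_cone_append[OF assms(2)] by blast
    moreover have "leaves T ! i \<in> set (leaves T)"
      using i assms(1) by simp
    ultimately show "replicate (length q) False @ x \<in> set (leaves T)"
      using q by metis
  qed
qed

section \<open>Prefixes of the normal form\<close>

lemma common_prefix_split: "\<exists>p u v. x = p @ u \<and> y = p @ v \<and> (u = [] \<or> v = [] \<or> hd u \<noteq> hd v)"
proof (induction x arbitrary: y)
  case (Cons a x)
  show ?case
  proof (cases "y \<noteq> [] \<and> hd y = a")
    case True
    then obtain y' where "y = a # y'"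
      by (cases y) auto
    then show ?thesis
      using Cons.IH[of y'] by (metis append_Cons)
  next
    case False
    then show ?thesis
      by (intro exI[of _ "[]"] exI[of _ "a # x"] exI[of _ y]) auto
  qed
qed simp

lemma eval_gammas:
  assumes "represents S T (eval w)"
  shows "eval (inv_word (gamma T) @ gamma S) = eval w"
proof -
  have "represents (rvine (carets T)) T (eval (inv_word (gamma T)))"
    using represents_gamma[of T] unfolding represents_def
    by (simp add: list_all2_conv_all_nth maps_cone_inv_word)
  then have "represents S T (eval (inv_word (gamma T) @ gamma S))"
    using represents_comp[OF represents_gamma[of S]] represents_carets[OF assms] by (simp add: eval_append)
  then show ?thesis
    using assms by (simp add: represents_iff)
qed

theorem theorem3p4:
  assumes "w \<in> thompsonF"
  shows "\<forall>i. 1 \<le> i \<and> i \<le> length (eta w) \<longrightarrow>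
           Nw (take (i - 1) (eta w)) \<le> Nw (take i (eta w))"
proof (intro allI impI)
  fix i
  assume i: "1 \<le> i \<and> i \<le> length (eta w)"
  obtain x where w: "w = eval x"
    using assms by (auto simp: thompsonF_def)
  define S T where "S = Tminus w" and "T = Tplus w"
  have ST: "represents S T (eval x)" "broken (eval x) = inner S"
    using rdiag_eval broken_eval by (simp_all add: S_def T_def w)
  obtain p u v where puv: "gamma T = p @ u" "gamma S = p @ v" "u = [] \<or> v = [] \<or> hd u \<noteq> hd v"
    using common_prefix_split by blast
  have eta: "eta w = inv_word u @ v"
    using free_red_common_prefix[of p u v] gamma_reduced puv by (metis S_def T_def eta_def)
  show "Nw (take (i - 1) (eta w)) \<le> Nw (take i (eta w))"
  proof (cases "i \<le> length u")
    case True
    \<comment> \<open>In the positive part, prefixes of \<open>eta w\<close> are inverses of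
      suffixes of \<open>u\<close>, hence of suffixes of \<open>gamma T\<close>.\<close>
    define n where "n = length u - i"
    define a s where "a = u ! n" and "s = drop (Suc n) u"
    have n: "n < length u"
      using True i unfolding n_def by arith
    have u: "u = take n u @ a # s"
      using n by (simp add: a_def s_def id_take_nth_drop)
    have len: "length s = i - 1"
      using True i by (simp add: s_def n_def)
    have "eta w = inv_word s @ [inv_letter a] @ inv_word (take n u) @ v"
      using u by (metis append.assoc eta inv_word_simps(2,3))
    then have "take (i - 1) (eta w) = inv_word s" "take i (eta w) = inv_word (a # s)"
      using len i by (simp_all add: take_Cons')
    moreover have "gamma T = (p @ take n u) @ a # s"
      using puv(1) u by simp
    then have "\<nexists>q. maps_cone (eval (a # s)) q (loc a)"
      using grows_gammaD unfolding grows_def by blast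
    ultimately show ?thesis
      using Nw_suffix by metis
  next
    case False
    define n where "n = i - 1 - length u"
    define a s where "a = v ! n" and "s = drop (Suc n) v"
    let ?pre = "p @ take n v"
    have n: "n < length v"
      using False i by (simp add: n_def eta)
    have v: "v = take n v @ a # s"
      using n by (simp add: a_def s_def id_take_nth_drop)
    have i': "i - 1 = length u + n" "i = length u + Suc n"
      using False by (simp_all add: n_def)
    have take: "take (i - 1) (eta w) = inv_word u @ take n v" "take i (eta w) = inv_word u @ take n v @ [a]"
      using n i' by (simp_all add: eta a_def take_Suc_conv_app_nth)
    \<comment> \<open>Restoring the cancelled \<open>p\<close> lets facts about positions in
      \<open>gamma S\<close> be applied.\<close>
    have cancel: "eval (inv_word (gamma T) @ p @ z) = eval (inv_word u @ z)" for z
    proof -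
      have "eval (inv_word (gamma T) @ p @ z) = eval (inv_word u) \<circ> (eval (inv_word p) \<circ> eval p) \<circ> eval z"
        by (simp add: puv(1) eval_append comp_assoc)
      then show ?thesis
        by (simp add: eval_inv_word eval_append)
    qed
    have S: "gamma S = ?pre @ a # s"
      using puv(2) v by simp
    then consider (inner) q r where "q \<in> inner S" "maps_cone (eval s) q (loc (inv_letter a) @ r)"
      | (run) "a = X0i" "set ?pre \<subseteq> {X0i}"
      using grows_gammaD[OF S] unfolding grows_def by blast
    then have "loc (inv_letter a) \<in> broken (eval (inv_word (gamma T) @ ?pre @ [a]))"
    proof cases
      case inner
      \<comment> \<open>The caret \<open>q\<close> of \<open>S\<close> is broken for
        \<open>w\<close>, so its image under \<open>eval s\<close> is broken for the other
        factor.\<close>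
      have "eval x = eval (inv_word (gamma T) @ ?pre @ [a]) \<circ> eval s"
        using eval_gammas[OF ST(1)] S by (simp flip: eval_append)
      then have "loc (inv_letter a) @ r \<in> broken (eval (inv_word (gamma T) @ ?pre @ [a]))"
        using inner ST(2) broken_comp_iff by metis
      then show ?thesis
        using broken_prefix by blast
    next
      case run
      define m where "m = Suc (length ?pre)"
      have m: "?pre @ [a] = replicate m X0i"
        by (rule replicate_eqI) (use run in \<open>auto simp: m_def\<close>)
      have "count_list (?pre @ [a]) X0i = m"
        unfolding m by (induction m) auto
      then have "m \<le> count_list (gamma S) X0i"
        using S run(1) by simp
      then have "m < carets T"
        using count_gamma[of S] S represents_carets[OF ST(1)] by auto
      \<comment> \<open>Otherwise \<open>u\<close> and \<open>v\<close> would begin with the same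
        letter, although \<open>p\<close> is their full common prefix.\<close>
      moreover have "\<nexists>z. gamma T = replicate m X0i @ z"
      proof
        assume "\<exists>z. gamma T = replicate m X0i @ z"
        then obtain z where "p @ u = ?pre @ [a] @ z"
          using puv(1) m by (metis append.assoc)
        then have "u = take n v @ [a] @ z"
          by simp
        moreover have "hd (xs @ a # s) = hd (xs @ [a] @ z)" for xs
          by (cases xs) auto
        then have "hd v = hd (take n v @ [a] @ z)"
          using v by metis
        ultimately show False
          using puv(3) n by auto
      qed
      ultimately show ?thesis
        using initial_run[of m T] run(1) m by (auto simp: broken_def loc_def)
    qed
    then have "loc (inv_letter a) \<in> broken (eval ((inv_word u @ take n v) @ [a]))"
      using cancel[of "take n v @ [a]"] by simp
    then show ?thesis
      using Nw_append_ge[of a "inv_word u @ take n v"] take by simp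
  qed
qed

end
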